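(* Let $M$ be a smooth manifold with an almost-complex structure $J$, and let $N$ be its Nijenhuis tensor. For a Riemannian metric $g$ on $M$, let $T:M\to\mathbb{R}$ be the weak form of $N^2$, i.e. the function $T=\mathrm{tr}_{1,3}\big(\mathrm{tr}_{2,4}\,L_g\big)$. Then $T$ is independent of the Riemannian metric $g$ and is the zero function: $T\equiv 0$ on $M$ (for every Riemannian metric $g$).
   Context: An almost-complex structure $J$ on a smooth manifold $M$ is a smooth $(1,1)$-tensor field (endomorphism of $TM$) with $J^2=-1$. Its Nijenhuis tensor is $N(X,Y)=[JX,JY]-J[X,JY]-J[JX,Y]-[X,Y]$ for smooth vector fields $X,Y$; it is tensorial. Given a Riemannian metric $g$, with $\langle\cdot,\cdot\rangle_g=g(\cdot,\cdot)$, define the tensor $L=L_g$ by $$L(X,Z,Y,W)=\tfrac14\Big\{\langle JN(N(X,Z),Y),W\rangle_g+\langle JN(N(Y,Z),X),W\rangle_g+\langle JN(N(X,W),Y),Z\rangle_g+\langle JN(N(Y,W),X),Z\rangle_g\Big\}.$$ $\mathrm{tr}_{a,b}$ denotes the metric trace (with respect to $g$) over the $a$-th and $b$-th arguments; thus in a local frame $\{e_i\}$ with $g_{ij}=g(e_i,e_j)$ and $(g^{ij})=(g_{ij})^{-1}$, $T=\sum_{i,j,k,l}g^{ij}g^{kl}L(e_i,e_k,e_j,e_l)$. *)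

theory Defs
  imports "HOL-Analysis.Analysis" "HOL-Library.Function_Algebras"
begin

(* Pointwise vector space structure on functions; addition comes from Function_Algebras.
   Tangent spaces below are linear subspaces of such a function space. *)

instantiation "fun" :: (type, real_vector) real_vector
begin

definition scaleR_fun :: "real \<Rightarrow> ('a \<Rightarrow> 'b) \<Rightarrow> 'a \<Rightarrow> 'b"
  where "scaleR_fun r f = (\<lambda>x. r *\<^sub>R f x)"

instance
  by standard (simp_all add: scaleR_fun_def plus_fun_def fun_eq_iff algebra_simps)

end


(* C^k and C^infinity maps. The set S is meant to be open, so that (at x) is the full
   neighbourhood filter and values of f outside S do not matter. *)

primrec Ck_on :: "nat \<Rightarrow> 'a::real_normed_vector set \<Rightarrow> ('a \<Rightarrow> 'b::real_normed_vector) \<Rightarrow> bool"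
  where
    "Ck_on 0 S f \<longleftrightarrow> continuous_on S f"
  | "Ck_on (Suc k) S f \<longleftrightarrow> (\<forall>x\<in>S. f differentiable (at x)) \<and>
       (\<forall>v. Ck_on k S (\<lambda>x. frechet_derivative f (at x) v))"

definition smooth_on :: "'a::real_normed_vector set \<Rightarrow> ('a \<Rightarrow> 'b::real_normed_vector) \<Rightarrow> bool"
  where "smooth_on S f \<longleftrightarrow> (\<forall>k. Ck_on k S f)"


(* A chart (U, \<phi>) has domain U; only the values of \<phi> on U matter. *)

type_synonym ('m, 'n) chart = "'m set \<times> ('m \<Rightarrow> real ^ 'n)"

abbreviation cdom :: "('m, 'n) chart \<Rightarrow> 'm set"
  where "cdom \<equiv> fst"

abbreviation cmap :: "('m, 'n) chart \<Rightarrow> 'm \<Rightarrow> real ^ 'n"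
  where "cmap \<equiv> snd"

definition cinv :: "('m, 'n) chart \<Rightarrow> real ^ 'n \<Rightarrow> 'm"
  where "cinv c = inv_into (cdom c) (cmap c)"

definition is_chart :: "('m::topological_space, 'n::finite) chart \<Rightarrow> bool"
  where "is_chart c \<longleftrightarrow> open (cdom c) \<and> open (cmap c ` cdom c) \<and>
    homeomorphism (cdom c) (cmap c ` cdom c) (cmap c) (cinv c)"

definition transition :: "('m, 'n) chart \<Rightarrow> ('m, 'n) chart \<Rightarrow> real ^ 'n \<Rightarrow> real ^ 'n"
  where "transition c d = cmap d \<circ> cinv c"

(* The atlas need not be maximal: every notion below depends only on the smooth structure
   generated by A. *)
definition smooth_atlas :: "('m::topological_space, 'n::finite) chart set \<Rightarrow> bool"
  where "smooth_atlas A \<longleftrightarrow>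
    (\<forall>c\<in>A. is_chart c) \<and> (\<Union>c\<in>A. cdom c) = UNIV \<and>
    (\<forall>c\<in>A. \<forall>d\<in>A. smooth_on (cmap c ` (cdom c \<inter> cdom d)) (transition c d))"


(* A tangent vector at p assigns to each chart of the atlas around p its vector of components,
   components in two charts being related by the Jacobian of the transition map. The value 0 at
   all other pairs makes this representation unique. *)

type_synonym ('m, 'n) tvec = "('m, 'n) chart \<Rightarrow> real ^ 'n"

definition charts_at :: "('m, 'n) chart set \<Rightarrow> 'm \<Rightarrow> ('m, 'n) chart set"
  where "charts_at A p = {c \<in> A. p \<in> cdom c}"

definition tangent_space ::
    "('m::topological_space, 'n::finite) chart set \<Rightarrow> 'm \<Rightarrow> ('m, 'n) tvec set"
  where "tangent_space A p =
    {v. (\<forall>c\<in>charts_at A p. \<forall>d\<in>charts_at A p.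
           v d = frechet_derivative (transition c d) (at (cmap c p)) (v c)) \<and>
        (\<forall>c. c \<notin> charts_at A p \<longrightarrow> v c = 0)}"

(* The tangent vector at p whose components in the chart c are a; for a = axis i 1 this is the
   i-th coordinate vector of c. *)
definition coord_vec ::
    "('m::topological_space, 'n::finite) chart set \<Rightarrow> ('m, 'n) chart \<Rightarrow> 'm \<Rightarrow> real ^ 'n \<Rightarrow> ('m, 'n) tvec"
  where "coord_vec A c p a =
    (\<lambda>d. if d \<in> charts_at A p then frechet_derivative (transition c d) (at (cmap c p)) a else 0)"

definition smooth_vector_field ::
    "('m::topological_space, 'n::finite) chart set \<Rightarrow> 'm set \<Rightarrow> ('m \<Rightarrow> ('m, 'n) tvec) \<Rightarrow> bool"
  where "smooth_vector_field A U X \<longleftrightarrow> open U \<and> (\<forall>p\<in>U. X p \<in> tangent_space A p) \<and>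
    (\<forall>c\<in>A. smooth_on (cmap c ` (U \<inter> cdom c)) (\<lambda>x. X (cinv c x) c))"

(* In coordinates, [X, Y]^k = X^i d_i Y^k - Y^i d_i X^k. *)
definition lie_bracket ::
    "('m::topological_space, 'n::finite) chart set \<Rightarrow> ('m \<Rightarrow> ('m, 'n) tvec) \<Rightarrow>
      ('m \<Rightarrow> ('m, 'n) tvec) \<Rightarrow> 'm \<Rightarrow> ('m, 'n) tvec"
  where "lie_bracket A X Y p =
    (\<lambda>c. if c \<in> charts_at A p
         then frechet_derivative (\<lambda>x. Y (cinv c x) c) (at (cmap c p)) (X p c)
            - frechet_derivative (\<lambda>x. X (cinv c x) c) (at (cmap c p)) (Y p c)
         else 0)"


definition almost_complex ::
    "('m::topological_space, 'n::finite) chart set \<Rightarrow> ('m \<Rightarrow> ('m, 'n) tvec \<Rightarrow> ('m, 'n) tvec) \<Rightarrow> bool"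
  where "almost_complex A J \<longleftrightarrow>
    (\<forall>p. \<forall>u\<in>tangent_space A p. J p u \<in> tangent_space A p) \<and>
    (\<forall>p. \<forall>u\<in>tangent_space A p. \<forall>v\<in>tangent_space A p. J p (u + v) = J p u + J p v) \<and>
    (\<forall>p r. \<forall>u\<in>tangent_space A p. J p (r *\<^sub>R u) = r *\<^sub>R J p u) \<and>
    (\<forall>c\<in>A. \<forall>a. smooth_on (cmap c ` cdom c)
       (\<lambda>x. J (cinv c x) (coord_vec A c (cinv c x) a) c)) \<and>
    (\<forall>p. \<forall>u\<in>tangent_space A p. J p (J p u) = - u)"

definition nijenhuis_field ::
    "('m::topological_space, 'n::finite) chart set \<Rightarrow> ('m \<Rightarrow> ('m, 'n) tvec \<Rightarrow> ('m, 'n) tvec) \<Rightarrow>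
      ('m \<Rightarrow> ('m, 'n) tvec) \<Rightarrow> ('m \<Rightarrow> ('m, 'n) tvec) \<Rightarrow> 'm \<Rightarrow> ('m, 'n) tvec"
  where "nijenhuis_field A J X Y p =
    (let JX = (\<lambda>q. J q (X q)); JY = (\<lambda>q. J q (Y q))
     in lie_bracket A JX JY p - J p (lie_bracket A X JY p) - J p (lie_bracket A JX Y p)
        - lie_bracket A X Y p)"

(* The value of the Nijenhuis tensor on u, v in the tangent space at p: the common value at p of
   N(X, Y) over all smooth vector fields X, Y near p that extend u, v. *)
definition nijenhuis ::
    "('m::topological_space, 'n::finite) chart set \<Rightarrow> ('m \<Rightarrow> ('m, 'n) tvec \<Rightarrow> ('m, 'n) tvec) \<Rightarrow>
      'm \<Rightarrow> ('m, 'n) tvec \<Rightarrow> ('m, 'n) tvec \<Rightarrow> ('m, 'n) tvec"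
  where "nijenhuis A J p u v =
    (THE w. \<forall>U X Y. p \<in> U \<and> smooth_vector_field A U X \<and> smooth_vector_field A U Y \<and>
        X p = u \<and> Y p = v \<longrightarrow> nijenhuis_field A J X Y p = w)"


definition riemannian_metric ::
    "('m::topological_space, 'n::finite) chart set \<Rightarrow>
      ('m \<Rightarrow> ('m, 'n) tvec \<Rightarrow> ('m, 'n) tvec \<Rightarrow> real) \<Rightarrow> bool"
  where "riemannian_metric A g \<longleftrightarrow>
    (\<forall>p. \<forall>u\<in>tangent_space A p. \<forall>v\<in>tangent_space A p. \<forall>w\<in>tangent_space A p.
       g p (u + v) w = g p u w + g p v w) \<and>
    (\<forall>p r. \<forall>u\<in>tangent_space A p. \<forall>v\<in>tangent_space A p. g p (r *\<^sub>R u) v = r * g p u v) \<and>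
    (\<forall>p. \<forall>u\<in>tangent_space A p. \<forall>v\<in>tangent_space A p. g p u v = g p v u) \<and>
    (\<forall>p. \<forall>u\<in>tangent_space A p. u \<noteq> 0 \<longrightarrow> 0 < g p u u) \<and>
    (\<forall>c\<in>A. \<forall>a b. smooth_on (cmap c ` cdom c)
       (\<lambda>x. g (cinv c x) (coord_vec A c (cinv c x) a) (coord_vec A c (cinv c x) b)))"

definition tangent_basis ::
    "('m::topological_space, 'n::finite) chart set \<Rightarrow> 'm \<Rightarrow> ('n \<Rightarrow> ('m, 'n) tvec) \<Rightarrow> bool"
  where "tangent_basis A p e \<longleftrightarrow>
    inj e \<and> independent (range e) \<and> span (range e) = tangent_space A p"

definition gram_matrix ::
    "('m \<Rightarrow> ('m, 'n) tvec \<Rightarrow> ('m, 'n) tvec \<Rightarrow> real) \<Rightarrow> 'm \<Rightarrow> ('n \<Rightarrow> ('m, 'n) tvec) \<Rightarrow> real ^ 'n ^ 'n"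
  where "gram_matrix g p e = (\<chi> i j. g p (e i) (e j))"

(* Metric trace of a bilinear form B on the tangent space at p: the number that
   sum_ij g^ij B(e_i, e_j) equals for every basis e. *)
definition metric_trace ::
    "('m::topological_space, 'n::finite) chart set \<Rightarrow>
      ('m \<Rightarrow> ('m, 'n) tvec \<Rightarrow> ('m, 'n) tvec \<Rightarrow> real) \<Rightarrow> 'm \<Rightarrow>
      (('m, 'n) tvec \<Rightarrow> ('m, 'n) tvec \<Rightarrow> real) \<Rightarrow> real"
  where "metric_trace A g p B =
    (THE t. \<forall>e. tangent_basis A p e \<longrightarrow>
       (\<Sum>i\<in>UNIV. \<Sum>j\<in>UNIV. matrix_inv (gram_matrix g p e) $ i $ j * B (e i) (e j)) = t)"

definition L_tensor ::
    "('m::topological_space, 'n::finite) chart set \<Rightarrow> ('m \<Rightarrow> ('m, 'n) tvec \<Rightarrow> ('m, 'n) tvec) \<Rightarrow>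
      ('m \<Rightarrow> ('m, 'n) tvec \<Rightarrow> ('m, 'n) tvec \<Rightarrow> real) \<Rightarrow> 'm \<Rightarrow>
      ('m, 'n) tvec \<Rightarrow> ('m, 'n) tvec \<Rightarrow> ('m, 'n) tvec \<Rightarrow> ('m, 'n) tvec \<Rightarrow> real"
  where "L_tensor A J g p X Z Y W =
    (let N = nijenhuis A J p in
     1 / 4 * (g p (J p (N (N X Z) Y)) W + g p (J p (N (N Y Z) X)) W
            + g p (J p (N (N X W) Y)) Z + g p (J p (N (N Y W) X)) Z))"

definition weak_N_squared ::
    "('m::topological_space, 'n::finite) chart set \<Rightarrow> ('m \<Rightarrow> ('m, 'n) tvec \<Rightarrow> ('m, 'n) tvec) \<Rightarrow>
      ('m \<Rightarrow> ('m, 'n) tvec \<Rightarrow> ('m, 'n) tvec \<Rightarrow> real) \<Rightarrow> 'm \<Rightarrow> real"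
  where "weak_N_squared A J g p =
    metric_trace A g p (\<lambda>X Y. metric_trace A g p (\<lambda>Z W. L_tensor A J g p X Z Y W))"

end

theory Submission
  imports Defs
begin

text \<open>
  The function vanishes because already the inner trace does. Write \<open>N\<^sub>X = N(X, -)\<close>.
  Contracting the metric with its inverse turns the trace of \<open>L(X, -, Y, -)\<close> into the metric-free
  quantity \<open>- 1/2 (tr (J N\<^sub>Y N\<^sub>X) + tr (J N\<^sub>X N\<^sub>Y))\<close>. Since
  \<open>N(X, JZ) = - J N(X, Z)\<close>, the endomorphism \<open>N\<^sub>X\<close> anticommutes with \<open>J\<close>, and cyclicity of the trace gives
  \<open>tr (J N\<^sub>Y N\<^sub>X) = tr (N\<^sub>X J N\<^sub>Y) = - tr (J N\<^sub>X N\<^sub>Y)\<close>.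

  In a chart, the derivatives of \<open>X\<close> and \<open>Y\<close> cancel in \<open>N(X, Y)\<close>, which leaves
  \<open>DJ(JX) Y - DJ(JY) X - J DJ(X) Y + J DJ(Y) X\<close>; this gives tensoriality, and differentiating
  \<open>J\<^sup>2 = -1\<close> gives the anticommutation.
\<close>

section \<open>Symmetry of second derivatives\<close>

text \<open>Two uses of the mean value theorem, first along \<open>u\<close> and then along
  \<open>v\<close>, write the double difference as \<open>t\<^sup>2 * f'' y v\<close> at some point
  \<open>y\<close> of the parallelogram spanned by \<open>t *\<^sub>R u\<close> and
  \<open>t *\<^sub>R v\<close>. Continuity of \<open>\<lambda>y. f'' y v\<close> then gives the
  limit. The quotient is symmetric in \<open>u\<close> and \<open>v\<close>, although its limit is
  not visibly so.\<close>

lemma double_difference_tendsto: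
  fixes f :: "'a::real_normed_vector \<Rightarrow> real"
  assumes "open S" "x \<in> S"
    and f: "\<And>y. y \<in> S \<Longrightarrow> (f has_derivative f' y) (at y)"
    and f': "\<And>y. y \<in> S \<Longrightarrow> ((\<lambda>z. f' z u) has_derivative f'' y) (at y)"
    and cont: "continuous_on S (\<lambda>y. f'' y v)"
  shows "((\<lambda>t. (f (x + t *\<^sub>R u + t *\<^sub>R v) - f (x + t *\<^sub>R u) - f (x + t *\<^sub>R v) + f x) / t\<^sup>2)
           \<longlongrightarrow> f'' x v) (at_right 0)"
proof (rule tendstoI)
  fix e :: real assume "e > 0"
  have "\<forall>\<^sub>F y in nhds x. dist (f'' y v) (f'' x v) < e"
    using cont assms(1,2) \<open>e > 0\<close>
    by (metis at_within_open continuous_on tendsto_at_iff_tendsto_nhds tendstoD)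
  moreover have "\<forall>\<^sub>F y in nhds x. y \<in> S"
    using assms(1,2) by (rule eventually_nhds_in_open)
  ultimately have "\<forall>\<^sub>F y in nhds x. y \<in> S \<and> dist (f'' y v) (f'' x v) < e"
    by eventually_elim simp
  then obtain d where d: "d > 0" "\<And>y. dist y x < d \<Longrightarrow> y \<in> S \<and> dist (f'' y v) (f'' x v) < e"
    by (auto simp: eventually_nhds_metric)
  \<comment> \<open>For \<open>t < \<delta>\<close> the whole parallelogram stays within distance
    \<open>d\<close> of \<open>x\<close>; the summand 1 keeps the denominator positive when
    \<open>u\<close> and \<open>v\<close> both vanish.\<close>
  define \<delta> where "\<delta> = d / (norm u + norm v + 1)"
  have pos: "norm u + norm v + 1 > 0"
    by (smt (verit) norm_ge_zero)
  have \<delta>: "\<delta> > 0"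
    using d(1) pos by (simp add: \<delta>_def)
  have near: "dist (x + s *\<^sub>R u + r *\<^sub>R v) x < d" if "0 \<le> s" "s \<le> t" "0 \<le> r" "r \<le> t" "t < \<delta>" for s r t
  proof -
    have "dist (x + s *\<^sub>R u + r *\<^sub>R v) x \<le> s * norm u + r * norm v"
      using that norm_triangle_ineq[of "s *\<^sub>R u" "r *\<^sub>R v"] by (simp add: dist_norm add.assoc)
    also have "\<dots> \<le> t * norm u + t * norm v"
      using that by (intro add_mono mult_right_mono) auto
    also have "\<dots> \<le> t * (norm u + norm v + 1)"
      using that by (simp add: algebra_simps)
    also have "\<dots> < d"
      using that(5) pos by (simp add: \<delta>_def pos_less_divide_eq)
    finally show ?thesis .
  qed
  have "dist ((f (x + t *\<^sub>R u + t *\<^sub>R v) - f (x + t *\<^sub>R u) - f (x + t *\<^sub>R v) + f x) / t\<^sup>2) (f'' x v) < e"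
    if t: "0 < t" "t < \<delta>" for t
  proof -
    have inS: "x + s *\<^sub>R u + r *\<^sub>R v \<in> S" if "0 \<le> s" "s \<le> t" "0 \<le> r" "r \<le> t" for s r
      using near[of s t r] that t d(2) by auto
    have inS': "x + s *\<^sub>R u \<in> S" if "0 \<le> s" "s \<le> t" for s
      using inS[of s 0] that t by simp
    \<comment> \<open>The increment of this function over \<open>{0..t}\<close> is the double
      difference, so the mean value theorem yields a first intermediate parameter
      \<open>s\<close>.\<close>
    have "((\<lambda>s. f (x + s *\<^sub>R u + t *\<^sub>R v) - f (x + s *\<^sub>R u)) has_derivative
        (\<lambda>h. f' (x + s *\<^sub>R u + t *\<^sub>R v) (h *\<^sub>R u) - f' (x + s *\<^sub>R u) (h *\<^sub>R u))) (at s within {0..t})"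
      if "0 \<le> s" "s \<le> t" for s
    proof (intro has_derivative_diff)
      show "((\<lambda>s. f (x + s *\<^sub>R u + t *\<^sub>R v)) has_derivative
          (\<lambda>h. f' (x + s *\<^sub>R u + t *\<^sub>R v) (h *\<^sub>R u))) (at s within {0..t})"
        by (rule has_derivative_compose[OF _ f]) (use that t inS in \<open>auto intro!: derivative_eq_intros\<close>)
      show "((\<lambda>s. f (x + s *\<^sub>R u)) has_derivative
          (\<lambda>h. f' (x + s *\<^sub>R u) (h *\<^sub>R u))) (at s within {0..t})"
        by (rule has_derivative_compose[OF _ f]) (use that t inS' in \<open>auto intro!: derivative_eq_intros\<close>)
    qed
    from mvt_simple[OF t(1) this] obtain s where s: "0 < s" "s < t" and
      "f (x + t *\<^sub>R u + t *\<^sub>R v) - f (x + t *\<^sub>R u) - (f (x + t *\<^sub>R v) - f x) =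
        f' (x + s *\<^sub>R u + t *\<^sub>R v) (t *\<^sub>R u) - f' (x + s *\<^sub>R u) (t *\<^sub>R u)"
      by auto
    moreover have "f' y (t *\<^sub>R u) = t * f' y u" if "y \<in> S" for y
      using linear_scale[OF has_derivative_linear[OF f[OF that]]] by simp
    ultimately have 1: "f (x + t *\<^sub>R u + t *\<^sub>R v) - f (x + t *\<^sub>R u) - f (x + t *\<^sub>R v) + f x =
        t * (f' (x + s *\<^sub>R u + t *\<^sub>R v) u - f' (x + s *\<^sub>R u) u)"
      using inS[of s t] inS'[of s] s t by (simp add: algebra_simps)
    \<comment> \<open>With \<open>s\<close> now fixed, the same argument along \<open>v\<close> is
      applied to the directional derivative \<open>f' _ u\<close>.\<close>
    have "((\<lambda>r. f' (x + s *\<^sub>R u + r *\<^sub>R v) u) has_derivative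
        (\<lambda>h. f'' (x + s *\<^sub>R u + r *\<^sub>R v) (h *\<^sub>R v))) (at r within {0..t})"
      if "0 \<le> r" "r \<le> t" for r
      by (rule has_derivative_compose[OF _ f']) (use that t s inS in \<open>auto intro!: derivative_eq_intros\<close>)
    from mvt_simple[OF t(1) this] obtain r where r: "0 < r" "r < t" and
      "f' (x + s *\<^sub>R u + t *\<^sub>R v) u - f' (x + s *\<^sub>R u) u = f'' (x + s *\<^sub>R u + r *\<^sub>R v) (t *\<^sub>R v)"
      by auto
    moreover have "f'' y (t *\<^sub>R v) = t * f'' y v" if "y \<in> S" for y
      using linear_scale[OF has_derivative_linear[OF f'[OF that]]] by simp
    ultimately have "f (x + t *\<^sub>R u + t *\<^sub>R v) - f (x + t *\<^sub>R u) - f (x + t *\<^sub>R v) + f x =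
        t\<^sup>2 * f'' (x + s *\<^sub>R u + r *\<^sub>R v) v"
      using 1 inS[of s r] s by (simp add: power2_eq_square)
    then have "(f (x + t *\<^sub>R u + t *\<^sub>R v) - f (x + t *\<^sub>R u) - f (x + t *\<^sub>R v) + f x) / t\<^sup>2 =
        f'' (x + s *\<^sub>R u + r *\<^sub>R v) v"
      using t by simp
    then show ?thesis
      using d(2) near[of s t r] s r t by auto
  qed
  then show "\<forall>\<^sub>F t in at_right 0. dist ((f (x + t *\<^sub>R u + t *\<^sub>R v) - f (x + t *\<^sub>R u)
      - f (x + t *\<^sub>R v) + f x) / t\<^sup>2) (f'' x v) < e"
    using \<delta> by (auto simp: eventually_at_right_field)
qed

text \<open>Exchanging \<open>u\<close> and \<open>v\<close> leaves the double difference quotient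
  unchanged, so the two limits agree. Here \<open>f'' w y\<close> is the derivative at
  \<open>y\<close> of \<open>\<lambda>z. f' z w\<close>.\<close>

lemma second_derivative_symmetric_real:
  fixes f :: "'a::real_normed_vector \<Rightarrow> real"
  assumes "open S" "x \<in> S"
    and "\<And>y. y \<in> S \<Longrightarrow> (f has_derivative f' y) (at y)"
    and "\<And>y w. y \<in> S \<Longrightarrow> ((\<lambda>z. f' z w) has_derivative f'' w y) (at y)"
    and "\<And>w h. continuous_on S (\<lambda>y. f'' w y h)"
  shows "f'' u x v = f'' v x u"
proof -
  have "((\<lambda>t. (f (x + t *\<^sub>R u + t *\<^sub>R v) - f (x + t *\<^sub>R u) - f (x + t *\<^sub>R v) + f x) / t\<^sup>2)
           \<longlongrightarrow> f'' u x v) (at_right 0)"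
    by (rule double_difference_tendsto[where f'' = "f'' u" and v = v, OF assms(1-5)])
  moreover have "((\<lambda>t. (f (x + t *\<^sub>R v + t *\<^sub>R u) - f (x + t *\<^sub>R v) - f (x + t *\<^sub>R u) + f x) / t\<^sup>2)
           \<longlongrightarrow> f'' v x u) (at_right 0)"
    by (rule double_difference_tendsto[where f'' = "f'' v" and v = u, OF assms(1-5)])
  ultimately show ?thesis
    by (intro tendsto_unique[of "at_right (0::real)"]) (simp_all add: algebra_simps)
qed

text \<open>The mean value argument is for real-valued functions, so it is applied to each component
  \<open>f y \<bullet> b\<close>.\<close>

lemma second_derivative_symmetric:
  fixes f :: "'a::real_normed_vector \<Rightarrow> 'b::euclidean_space"
  assumes "open S" "x \<in> S"
    and f: "\<And>y. y \<in> S \<Longrightarrow> (f has_derivative f' y) (at y)"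
    and f': "\<And>y w. y \<in> S \<Longrightarrow> ((\<lambda>z. f' z w) has_derivative f'' w y) (at y)"
    and "\<And>w h. continuous_on S (\<lambda>y. f'' w y h)"
  shows "f'' u x v = f'' v x u"
proof (rule euclidean_eqI)
  fix b :: 'b
  show "f'' u x v \<bullet> b = f'' v x u \<bullet> b"
    by (rule second_derivative_symmetric_real[where f = "\<lambda>y. f y \<bullet> b" and f' = "\<lambda>y w. f' y w \<bullet> b"
          and f'' = "\<lambda>w y h. f'' w y h \<bullet> b" and S = S])
      (use assms in \<open>auto intro!: has_derivative_inner_left continuous_intros\<close>)
qed

section \<open>Smooth maps\<close>

lemma Ck_on_imp_continuous_on: "Ck_on k S f \<Longrightarrow> continuous_on S f"
  by (cases k) (auto intro!: differentiable_imp_continuous_on differentiable_at_imp_differentiable_on)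

lemma Ck_on_Suc_D: "Ck_on (Suc k) S f \<Longrightarrow> Ck_on k S f"
proof (induction k arbitrary: f)
  case 0
  then show ?case
    using Ck_on_imp_continuous_on by fastforce
next
  case (Suc k)
  then show ?case
    by (metis Ck_on.simps(2))
qed

text \<open>On an open set the derivative at a point depends only on nearby values inside the set,
  so agreement on \<open>S\<close> passes to all derivatives.\<close>

lemma Ck_on_cong:
  assumes "open S" "\<And>x. x \<in> S \<Longrightarrow> f x = g x" "Ck_on k S f"
  shows "Ck_on k S g"
  using assms(2,3)
proof (induction k arbitrary: f g)
  case 0
  then show ?case by (metis Ck_on.simps(1) continuous_on_cong)
next
  case (Suc k)
  have d: "f differentiable at x" if "x \<in> S" for x
    using Suc.prems that by auto
  have eq: "frechet_derivative f (at x) = frechet_derivative g (at x)" if "x \<in> S" for x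
    using frechet_derivative_transform_within_open[OF d assms(1)] that Suc.prems by blast
  have "g differentiable at x" if "x \<in> S" for x
    using d[OF that] has_derivative_transform_within_open[OF _ assms(1) that] Suc.prems(1)
    unfolding differentiable_def by blast
  moreover have "Ck_on k S (\<lambda>x. frechet_derivative g (at x) v)" for v
    by (rule Suc.IH[of "\<lambda>x. frechet_derivative f (at x) v"]) (use eq Suc.prems in auto)
  ultimately show ?case by simp
qed

lemma Ck_on_subset:
  assumes "Ck_on k S f" "T \<subseteq> S"
  shows "Ck_on k T f"
  using assms by (induction k arbitrary: f) (auto intro: continuous_on_subset)

text \<open>This lets the inductions below use an explicit derivative formula \<open>f'\<close> in
  place of \<open>frechet_derivative\<close>.\<close>

lemma Ck_on_Suc_I:
  assumes "open S" "\<And>x. x \<in> S \<Longrightarrow> (f has_derivative f' x) (at x)"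
    "\<And>v. Ck_on k S (\<lambda>x. f' x v)"
  shows "Ck_on (Suc k) S f"
proof -
  have "f' x v = frechet_derivative f (at x) v" if "x \<in> S" for x v
    using frechet_derivative_at[OF assms(2)[OF that]] by simp
  then have "Ck_on k S (\<lambda>x. frechet_derivative f (at x) v)" for v
    by (rule Ck_on_cong[OF assms(1) _ assms(3)])
  then show ?thesis
    using assms(2) by (auto intro: differentiableI)
qed

lemma Ck_on_Suc_has_derivative:
  "Ck_on (Suc k) S f \<Longrightarrow> x \<in> S \<Longrightarrow> (f has_derivative frechet_derivative f (at x)) (at x)"
  by (simp add: frechet_derivative_works)

lemma Ck_on_const: "open S \<Longrightarrow> Ck_on k S (\<lambda>x. c)"
  by (induction k arbitrary: c) (auto intro!: continuous_intros)

lemma Ck_on_add: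
  assumes "open S" "Ck_on k S f" "Ck_on k S g"
  shows "Ck_on k S (\<lambda>x. f x + g x)"
  using assms(2,3)
proof (induction k arbitrary: f g)
  case 0
  then show ?case by (simp add: continuous_on_add)
next
  case (Suc k)
  note D = Suc.prems[THEN Ck_on_Suc_has_derivative]
  show ?case
  proof (rule Ck_on_Suc_I[OF assms(1) has_derivative_add[OF D]])
    show "Ck_on k S (\<lambda>x. frechet_derivative f (at x) v + frechet_derivative g (at x) v)" for v
      using Suc.prems by (intro Suc.IH) simp_all
  qed
qed

lemma Ck_on_scaleR:
  fixes r :: "'a::real_normed_vector \<Rightarrow> real" and f :: "'a \<Rightarrow> 'b::real_normed_vector"
  assumes "open S" "Ck_on k S r" "Ck_on k S f"
  shows "Ck_on k S (\<lambda>x. r x *\<^sub>R f x)"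
  using assms(2,3)
proof (induction k arbitrary: r f)
  case 0
  then show ?case by (simp add: continuous_on_scaleR)
next
  case (Suc k)
  note D = Suc.prems[THEN Ck_on_Suc_has_derivative]
  show ?case
  proof (rule Ck_on_Suc_I[OF assms(1) has_derivative_scaleR[OF D]])
    show "Ck_on k S (\<lambda>x. r x *\<^sub>R frechet_derivative f (at x) v + frechet_derivative r (at x) v *\<^sub>R f x)" for v
      \<comment> \<open>The product rule leaves one factor undifferentiated in each term; that
        factor has to be lowered from level \<open>Suc k\<close> to level \<open>k\<close> before
        the induction hypothesis applies.\<close>
      using Suc.prems Suc.prems[THEN Ck_on_Suc_D]
      by (intro Ck_on_add[OF assms(1)] Suc.IH) simp_all
  qed
qed

lemma Ck_on_sum:
  assumes "open S" "\<And>i. i \<in> I \<Longrightarrow> Ck_on k S (f i)"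
  shows "Ck_on k S (\<lambda>x. \<Sum>i\<in>I. f i x)"
  using assms(2)
  by (induction I rule: infinite_finite_induct) (auto intro!: Ck_on_const Ck_on_add assms(1))

lemma Ck_on_bounded_linear:
  assumes "open S" "bounded_linear L" "Ck_on k S f"
  shows "Ck_on k S (\<lambda>x. L (f x))"
  using assms(3)
proof (induction k arbitrary: f)
  case 0
  then show ?case using bounded_linear.continuous_on[OF assms(2), of S f] by simp
next
  case (Suc k)
  note D = Suc.prems[THEN Ck_on_Suc_has_derivative]
  show ?case
  proof (rule Ck_on_Suc_I[OF assms(1) bounded_linear.has_derivative[OF assms(2) D]])
    show "Ck_on k S (\<lambda>x. L (frechet_derivative f (at x) v))" for v
      using Suc.prems by (intro Suc.IH) simp
  qed
qed

lemma linear_euclidean_expand: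
  fixes f :: "'a::euclidean_space \<Rightarrow> 'b::real_vector"
  assumes "linear f"
  shows "f x = (\<Sum>b\<in>Basis. (x \<bullet> b) *\<^sub>R f b)"
proof -
  have "f x = f (\<Sum>b\<in>Basis. (x \<bullet> b) *\<^sub>R b)"
    by (simp add: euclidean_representation)
  also have "\<dots> = (\<Sum>b\<in>Basis. (x \<bullet> b) *\<^sub>R f b)"
    by (simp only: linear_sum[OF assms] linear_scale[OF assms])
  finally show ?thesis .
qed

text \<open>Expanding \<open>X x\<close> in the standard basis gives a finite sum of scalar
  functions times \<open>M x b\<close> with \<open>b\<close> fixed. This handles the derivative in
  the chain rule, where both the linear map and its argument vary with the point.\<close>

lemma Ck_on_linear_apply:
  fixes M :: "'a::real_normed_vector \<Rightarrow> 'b::euclidean_space \<Rightarrow> 'c::real_normed_vector"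
  assumes "open S" "\<And>x. x \<in> S \<Longrightarrow> linear (M x)" "\<And>b. Ck_on k S (\<lambda>x. M x b)" "Ck_on k S X"
  shows "Ck_on k S (\<lambda>x. M x (X x))"
proof (rule Ck_on_cong[OF assms(1)])
  show "(\<Sum>b\<in>Basis. (X x \<bullet> b) *\<^sub>R M x b) = M x (X x)" if "x \<in> S" for x
    using linear_euclidean_expand[OF assms(2)[OF that], of "X x"] by (rule sym)
  show "Ck_on k S (\<lambda>x. \<Sum>b\<in>Basis. (X x \<bullet> b) *\<^sub>R M x b)"
    by (rule Ck_on_sum[OF assms(1) Ck_on_scaleR[OF assms(1)
          Ck_on_bounded_linear[OF assms(1) bounded_linear_inner_left assms(4)] assms(3)]])
qed

text \<open>Induction on \<open>k\<close> with \<open>f\<close> generalised: the chain rule produces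
  the derivative of \<open>f\<close> along \<open>g\<close>, which for each fixed direction is again
  a composition with \<open>g\<close>, one level lower.\<close>

lemma Ck_on_compose:
  fixes f :: "'b::euclidean_space \<Rightarrow> 'c::real_normed_vector" and g :: "'a::real_normed_vector \<Rightarrow> 'b"
  assumes "open S" "open T" "g ` S \<subseteq> T" "Ck_on k S g" "Ck_on k T f"
  shows "Ck_on k S (\<lambda>x. f (g x))"
  using assms(4,5)
proof (induction k arbitrary: f)
  case 0
  then have "continuous_on T f" "continuous_on S g" by simp_all
  then show ?case
    unfolding Ck_on.simps by (rule continuous_on_compose2[OF _ _ assms(3)])
next
  case (Suc k)
  have D: "((\<lambda>x. f (g x)) has_derivative
      (\<lambda>h. frechet_derivative f (at (g x)) (frechet_derivative g (at x) h))) (at x)" if "x \<in> S" for x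
    by (rule has_derivative_compose[OF Ck_on_Suc_has_derivative[OF Suc.prems(1) that]
          Ck_on_Suc_has_derivative[OF Suc.prems(2)]])
      (use that assms(3) in blast)
  show ?case
  proof (rule Ck_on_Suc_I[OF assms(1) D])
    fix v
    show "Ck_on k S (\<lambda>x. frechet_derivative f (at (g x)) (frechet_derivative g (at x) v))"
    proof (rule Ck_on_linear_apply[OF assms(1)])
      show "linear (frechet_derivative f (at (g x)))" if "x \<in> S" for x
        using Suc.prems(2) assms(3) that by (intro linear_frechet_derivative) auto
      show "Ck_on k S (\<lambda>x. frechet_derivative f (at (g x)) b)" for b
        using Suc.prems(2) by (intro Suc.IH[OF Ck_on_Suc_D[OF Suc.prems(1)]]) simp
      show "Ck_on k S (\<lambda>x. frechet_derivative g (at x) v)"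
        using Suc.prems(1) by simp
    qed
  qed
qed

lemma smooth_on_cong:
  "open S \<Longrightarrow> (\<And>x. x \<in> S \<Longrightarrow> f x = g x) \<Longrightarrow> smooth_on S f \<Longrightarrow> smooth_on S g"
  unfolding smooth_on_def using Ck_on_cong by blast

lemma smooth_on_subset: "smooth_on S f \<Longrightarrow> T \<subseteq> S \<Longrightarrow> smooth_on T f"
  unfolding smooth_on_def using Ck_on_subset by blast

lemma smooth_on_compose:
  fixes f :: "'b::euclidean_space \<Rightarrow> 'c::real_normed_vector" and g :: "'a::real_normed_vector \<Rightarrow> 'b"
  assumes "open S" "open T" "g ` S \<subseteq> T" "smooth_on S g" "smooth_on T f"
  shows "smooth_on S (\<lambda>x. f (g x))"
  unfolding smooth_on_def
proof
  fix k
  show "Ck_on k S (\<lambda>x. f (g x))"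
    by (rule Ck_on_compose[OF assms(1-3)]) (use assms(4,5) in \<open>simp_all add: smooth_on_def\<close>)
qed

lemma smooth_on_differentiable: "smooth_on S f \<Longrightarrow> x \<in> S \<Longrightarrow> f differentiable at x"
  by (metis Ck_on.simps(2) smooth_on_def)

lemma smooth_on_has_derivative:
  "smooth_on S f \<Longrightarrow> x \<in> S \<Longrightarrow> (f has_derivative frechet_derivative f (at x)) (at x)"
  by (simp add: frechet_derivative_works[symmetric] smooth_on_differentiable)

lemma smooth_on_frechet_derivative:
  "smooth_on S f \<Longrightarrow> smooth_on S (\<lambda>x. frechet_derivative f (at x) v)"
  by (metis Ck_on.simps(2) smooth_on_def)

lemma smooth_on_second_derivative_symmetric:
  fixes f :: "'a::real_normed_vector \<Rightarrow> 'b::euclidean_space"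
  assumes "open S" "x \<in> S" "smooth_on S f"
  shows "frechet_derivative (\<lambda>y. frechet_derivative f (at y) u) (at x) v =
         frechet_derivative (\<lambda>y. frechet_derivative f (at y) v) (at x) u"
proof (rule second_derivative_symmetric[OF assms(1,2)])
  show "(f has_derivative frechet_derivative f (at y)) (at y)" if "y \<in> S" for y
    using assms(3) that by (rule smooth_on_has_derivative)
  show "((\<lambda>z. frechet_derivative f (at z) w) has_derivative
      frechet_derivative (\<lambda>y. frechet_derivative f (at y) w) (at y)) (at y)" if "y \<in> S" for y w
    using smooth_on_frechet_derivative[OF assms(3)] that by (rule smooth_on_has_derivative)
  show "continuous_on S (\<lambda>y. frechet_derivative (\<lambda>y. frechet_derivative f (at y) w) (at y) h)" for w h
    using smooth_on_frechet_derivative[OF smooth_on_frechet_derivative[OF assms(3)]]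
    by (metis Ck_on.simps(1) smooth_on_def)
qed

text \<open>A product rule for an operator-valued map known only through its values on fixed
  vectors. After expansion in a basis the ordinary product rule applies to each summand.\<close>

lemma has_derivative_linear_apply:
  fixes M :: "'a::real_normed_vector \<Rightarrow> 'b::euclidean_space \<Rightarrow> 'c::real_normed_vector"
  assumes "open S" "x \<in> S" and lin: "\<And>y. y \<in> S \<Longrightarrow> linear (M y)"
    and M: "\<And>b. ((\<lambda>y. M y b) has_derivative M' b) (at x)"
    and X: "(X has_derivative X') (at x)"
  shows "((\<lambda>y. M y (X y)) has_derivative (\<lambda>h. M x (X' h) + M' (X x) h)) (at x)"
proof -
  have "((\<lambda>y. \<Sum>b\<in>Basis. (z \<bullet> b) *\<^sub>R M y b) has_derivative (\<lambda>h. \<Sum>b\<in>Basis. (z \<bullet> b) *\<^sub>R M' b h)) (at x)" for z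
    by (intro has_derivative_sum has_derivative_scaleR_right M)
  then have "((\<lambda>y. M y z) has_derivative (\<lambda>h. \<Sum>b\<in>Basis. (z \<bullet> b) *\<^sub>R M' b h)) (at x)" for z
    by (rule has_derivative_transform_within_open[OF _ assms(1,2)])
      (simp add: linear_euclidean_expand[OF lin, symmetric])
  \<comment> \<open>Uniqueness of derivatives makes \<open>M'\<close> linear in its first argument,
    so the sum over the basis can be collapsed to \<open>M' (X x) h\<close>.\<close>
  then have M'_expand: "M' z = (\<lambda>h. \<Sum>b\<in>Basis. (z \<bullet> b) *\<^sub>R M' b h)" for z
    using M has_derivative_unique by blast
  have "((\<lambda>y. \<Sum>b\<in>Basis. (X y \<bullet> b) *\<^sub>R M y b) has_derivative
      (\<lambda>h. \<Sum>b\<in>Basis. (X x \<bullet> b) *\<^sub>R M' b h + (X' h \<bullet> b) *\<^sub>R M x b)) (at x)"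
    by (intro has_derivative_sum has_derivative_scaleR M has_derivative_inner_left X)
  moreover have "(\<Sum>b\<in>Basis. (X x \<bullet> b) *\<^sub>R M' b h + (X' h \<bullet> b) *\<^sub>R M x b) = M x (X' h) + M' (X x) h" for h
    unfolding sum.distrib linear_euclidean_expand[OF lin[OF assms(2)], of "X' h", symmetric]
    by (subst M'_expand) (rule add.commute)
  ultimately have "((\<lambda>y. \<Sum>b\<in>Basis. (X y \<bullet> b) *\<^sub>R M y b) has_derivative
      (\<lambda>h. M x (X' h) + M' (X x) h)) (at x)"
    by simp
  then show ?thesis
    by (rule has_derivative_transform_within_open[OF _ assms(1,2)])
      (simp add: linear_euclidean_expand[OF lin, symmetric])
qed

text \<open>The linearity identities of \<open>M y\<close> hold on a whole neighbourhood of
  \<open>x\<close>, hence can be differentiated; uniqueness of derivatives identifies both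
  sides.\<close>

lemma has_derivative_linear_apply_linear:
  fixes M :: "'a::real_normed_vector \<Rightarrow> 'b::real_vector \<Rightarrow> 'c::real_normed_vector"
  assumes "open S" "x \<in> S" and lin: "\<And>y. y \<in> S \<Longrightarrow> linear (M y)"
    and M: "\<And>b. ((\<lambda>y. M y b) has_derivative M' b) (at x)"
  shows "linear (\<lambda>b. M' b h)"
proof (rule linearI)
  show "M' (a + b) h = M' a h + M' b h" for a b
  proof -
    have "((\<lambda>y. M y (a + b)) has_derivative (\<lambda>h. M' a h + M' b h)) (at x)"
      by (rule has_derivative_transform_within_open[OF has_derivative_add[OF M M] assms(1,2)])
        (simp add: linear_add[OF lin])
    from has_derivative_unique[OF M this] show ?thesis by metis
  qed
  show "M' (r *\<^sub>R a) h = r *\<^sub>R M' a h" for r a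
  proof -
    have "((\<lambda>y. M y (r *\<^sub>R a)) has_derivative (\<lambda>h. r *\<^sub>R M' a h)) (at x)"
      by (rule has_derivative_transform_within_open[OF has_derivative_scaleR_right[OF M] assms(1,2)])
        (simp add: linear_scale[OF lin])
    from has_derivative_unique[OF M this] show ?thesis by metis
  qed
qed

section \<open>Metric contractions\<close>

lemma matrix_inv_left_inverse:
  fixes G :: "real^'n^'n"
  assumes "\<And>x. G *v x = 0 \<Longrightarrow> x = 0"
  shows "matrix_inv G ** G = mat 1"
proof -
  have "invertible G"
    using assms matrix_left_invertible_ker[of G] invertible_left_inverse[of G] by blast
  then show ?thesis
    unfolding invertible_def matrix_inv_def by (rule someI2_ex) simp
qed

lemma trace_matrix_mult: "trace (X ** Y) = (\<Sum>k\<in>UNIV. \<Sum>l\<in>UNIV. X $ k $ l * Y $ l $ k)"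
  by (simp add: trace_def matrix_matrix_mult_def)

lemma trace_transpose: "trace (transpose X) = trace X"
  by (simp add: trace_def transpose_def)

lemma bilinear_form_matrix:
  fixes b :: "real^'n \<Rightarrow> real^'n \<Rightarrow> real"
  assumes "bilinear b"
  obtains H where "\<And>x y. b x y = x \<bullet> (H *v y)" "\<And>i j. H $ i $ j = b (axis i 1) (axis j 1)"
proof
  let ?f = "\<lambda>y. \<chi> i. b (axis i 1) y"
  have "linear ?f"
    by (rule linearI) (simp_all add: vec_eq_iff bilinear_radd[OF assms] bilinear_rmul[OF assms])
  then have H: "matrix ?f *v y = ?f y" for y
    by (rule matrix_vector_mul(2)[THEN fun_cong])
  show "b x y = x \<bullet> (matrix ?f *v y)" for x y
  proof -
    have lin: "linear (\<lambda>x. b x y)"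
      using assms by (simp add: bilinear_def)
    have "b x y = b (\<Sum>i\<in>UNIV. x $ i *\<^sub>R axis i 1) y"
      using basis_expansion[of x] by (simp add: scalar_mult_eq_scaleR)
    also have "\<dots> = (\<Sum>i\<in>UNIV. x $ i * b (axis i 1) y)"
      by (simp add: linear_sum[OF lin] linear_scale[OF lin])
    finally show ?thesis
      unfolding H by (simp add: inner_vec_def)
  qed
  show "matrix ?f $ i $ j = b (axis i 1) (axis j 1)" for i j
    by (simp add: matrix_def)
qed

text \<open>Let \<open>P\<close> have the vectors \<open>e k\<close> as columns and let
  \<open>H\<close> be the matrix of \<open>b\<close>. Then G = P^T H P, so P G^-1 P^T = H^-1, and
  both sums become the trace of \<open>A\<close> after cyclic permutation. The result involves
  neither \<open>b\<close> nor \<open>e\<close>, which is how the metric drops out.\<close>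

lemma gram_contraction:
  fixes b :: "real^'n \<Rightarrow> real^'n \<Rightarrow> real" and e :: "'n \<Rightarrow> real^'n" and A :: "real^'n^'n"
  assumes "bilinear b" and sym: "\<And>x y. b x y = b y x" and pos: "\<And>x. x \<noteq> 0 \<Longrightarrow> 0 < b x x"
    and indep: "\<And>z :: real^'n. (\<Sum>i\<in>UNIV. z $ i *\<^sub>R e i) = 0 \<Longrightarrow> z = 0"
  defines "G \<equiv> (\<chi> i j. b (e i) (e j)) :: real^'n^'n"
  shows "(\<Sum>k\<in>UNIV. \<Sum>l\<in>UNIV. matrix_inv G $ k $ l * b (A *v e k) (e l)) = trace A"
    and "(\<Sum>k\<in>UNIV. \<Sum>l\<in>UNIV. matrix_inv G $ k $ l * b (A *v e l) (e k)) = trace A"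
proof -
  obtain H where H: "\<And>x y. b x y = x \<bullet> (H *v y)" "\<And>i j. H $ i $ j = b (axis i 1) (axis j 1)"
    by (rule bilinear_form_matrix[OF assms(1)]) (rule that)
  have H_sym: "transpose H = H"
    unfolding vec_eq_iff transpose_def using sym by (simp add: H(2))
  define P :: "real^'n^'n" where "P = (\<chi> i k. e k $ i)"
  have P: "P *v z = (\<Sum>i\<in>UNIV. z $ i *\<^sub>R e i)" for z
    by (simp add: vec_eq_iff P_def matrix_vector_mult_def mult.commute)
  have col: "X $ i $ k = (X *v axis k 1) $ i" for X :: "real^'n^'n" and i k
    by (simp add: matrix_vector_mult_basis column_def)
  have entry: "b (X *v axis k 1) (Y *v axis l 1) = (transpose X ** H ** Y) $ k $ l"
    for X Y :: "real^'n^'n" and k l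
  proof -
    have "b (X *v axis k 1) (Y *v axis l 1) = (transpose X *v (H *v (Y *v axis l 1))) \<bullet> axis k 1"
      by (simp add: H(1) dot_lmul_matrix inner_commute[of "X *v axis k 1"])
    also have "\<dots> = ((transpose X ** H ** Y) *v axis l 1) $ k"
      by (simp add: inner_axis matrix_vector_mul_assoc matrix_mul_assoc del: transpose_matrix_vector)
    finally show ?thesis unfolding col .
  qed
  have e: "e k = P *v axis k 1" for k
    by (simp add: vec_eq_iff P_def matrix_vector_mult_basis column_def)
  have G: "G = transpose P ** H ** P"
    by (simp add: vec_eq_iff G_def e entry)
  \<comment> \<open>If \<open>G *v z = 0\<close>, then \<open>b (P *v z) (P *v z) = 0\<close>;
    definiteness of \<open>b\<close> and independence of the \<open>e i\<close> force
    \<open>z = 0\<close>.\<close>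
  have "matrix_inv G ** G = mat 1"
  proof (rule matrix_inv_left_inverse)
    fix z assume "G *v z = 0"
    then have "0 = z \<bullet> (transpose P *v (H *v (P *v z)))"
      by (simp add: G matrix_vector_mul_assoc matrix_mul_assoc del: transpose_matrix_vector)
    also have "\<dots> = b (P *v z) (P *v z)"
      by (simp add: H(1) inner_commute[of z] inner_commute[of "P *v z"] dot_lmul_matrix)
    finally have "P *v z = 0"
      using pos by (metis less_irrefl)
    then show "z = 0"
      using indep by (simp add: P)
  qed
  \<comment> \<open>\<open>K\<close> is the inverse metric in standard coordinates. Cancelling the
    invertible \<open>P\<close> from \<open>K ** H ** P = P\<close> shows that it inverts
    \<open>H\<close>.\<close>
  define K where "K = P ** matrix_inv G ** transpose P"
  obtain Q where "Q ** P = mat 1"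
    using matrix_left_invertible_ker[of P] indep by (auto simp: P)
  then have PQ: "P ** Q = mat 1"
    by (simp add: matrix_left_right_inverse)
  have "K ** H ** P = P"
    using \<open>matrix_inv G ** G = mat 1\<close> by (simp add: K_def G matrix_mul_assoc[symmetric])
  then have KH: "K ** H = mat 1"
    by (metis PQ matrix_mul_assoc matrix_mul_rid)
  then have HK: "H ** K = mat 1"
    by (simp add: matrix_left_right_inverse)
  have Ae: "b (A *v e k) (e l) = (transpose (A ** P) ** H ** P) $ k $ l" for k l
    using entry[of "A ** P" k P l] by (simp add: e matrix_vector_mul_assoc)
  have "(\<Sum>k\<in>UNIV. \<Sum>l\<in>UNIV. matrix_inv G $ k $ l * b (A *v e l) (e k)) =
      trace (matrix_inv G ** (transpose P ** transpose A ** H ** P))"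
    by (simp add: trace_matrix_mult Ae matrix_transpose_mul)
  also have "\<dots> = trace ((matrix_inv G ** transpose P ** transpose A ** H) ** P)"
    by (simp add: matrix_mul_assoc)
  also have "\<dots> = trace ((K ** transpose A) ** H)"
    by (subst trace_mul_sym) (simp add: K_def matrix_mul_assoc)
  also have "\<dots> = trace A"
    by (subst trace_mul_sym) (simp add: matrix_mul_assoc HK trace_transpose)
  finally show "(\<Sum>k\<in>UNIV. \<Sum>l\<in>UNIV. matrix_inv G $ k $ l * b (A *v e l) (e k)) = trace A" .
  \<comment> \<open>Here the index order is opposite to that in \<open>trace_matrix_mult\<close>,
    hence the outer transpose; the symmetry of \<open>H\<close> absorbs it.\<close>
  have "(\<Sum>k\<in>UNIV. \<Sum>l\<in>UNIV. matrix_inv G $ k $ l * b (A *v e k) (e l)) =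
      trace (matrix_inv G ** transpose (transpose (A ** P) ** H ** P))"
    unfolding trace_matrix_mult Ae by (simp add: transpose_def)
  also have "\<dots> = trace ((matrix_inv G ** transpose P ** H ** A) ** P)"
    by (simp add: matrix_transpose_mul H_sym matrix_mul_assoc)
  also have "\<dots> = trace (K ** H ** A)"
    by (subst trace_mul_sym) (simp add: K_def matrix_mul_assoc)
  finally show "(\<Sum>k\<in>UNIV. \<Sum>l\<in>UNIV. matrix_inv G $ k $ l * b (A *v e k) (e l)) = trace A"
    by (simp add: KH)
qed

text \<open>Cyclicity brings \<open>X\<close> to the front of \<open>J ** Y ** X\<close>, and moving
  it past \<open>J\<close> costs a sign.\<close>

lemma trace_anticommuting:
  fixes J X Y :: "real^'n^'n"
  assumes "X ** J = - (J ** X)"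
  shows "trace (J ** X ** Y) + trace (J ** Y ** X) = 0"
proof -
  have "trace (J ** Y ** X) = trace (X ** J ** Y)"
    by (subst trace_mul_sym) (simp add: matrix_mul_assoc)
  also have "\<dots> = - trace (J ** X ** Y)"
    unfolding assms by (simp add: trace_def matrix_matrix_mult_def sum_negf)
  finally show ?thesis by simp
qed

text \<open>The linear algebra of the inner trace, stated on coordinate space with \<open>x\<close>
  and \<open>y\<close> fixed. Each of the four terms contracts to the trace of an endomorphism, and
  these traces cancel by \<open>trace_anticommuting\<close>.\<close>

lemma contraction_eq_0:
  fixes b :: "real^'n \<Rightarrow> real^'n \<Rightarrow> real" and e :: "'n \<Rightarrow> real^'n"
    and J :: "real^'n \<Rightarrow> real^'n" and N :: "real^'n \<Rightarrow> real^'n \<Rightarrow> real^'n"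
  assumes b: "bilinear b" "\<And>x y. b x y = b y x" "\<And>x. x \<noteq> 0 \<Longrightarrow> 0 < b x x"
    and e: "\<And>z :: real^'n. (\<Sum>i\<in>UNIV. z $ i *\<^sub>R e i) = 0 \<Longrightarrow> z = 0"
    and J: "linear J" and N: "bilinear N" "\<And>x y. N x y = - N y x" "\<And>x y. N x (J y) = - J (N x y)"
  defines "G \<equiv> (\<chi> i j. b (e i) (e j)) :: real^'n^'n"
  shows "(\<Sum>k\<in>UNIV. \<Sum>l\<in>UNIV. matrix_inv G $ k $ l *
           (1 / 4 * (b (J (N (N x (e k)) y)) (e l) + b (J (N (N y (e k)) x)) (e l)
                   + b (J (N (N x (e l)) y)) (e k) + b (J (N (N y (e l)) x)) (e k)))) = 0"
proof -
  let ?J = "matrix J" and ?N = "\<lambda>x. matrix (N x)"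
  have N_lin: "linear (N x)" for x
    using N(1) by (simp add: bilinear_def)
  have mv: "matrix f *v z = f z" if "linear f" for f :: "real^'n \<Rightarrow> real^'n" and z
    using that by (rule matrix_vector_mul(2)[THEN fun_cong])
  have anti: "?N x ** ?J = - (?J ** ?N x)" for x
  proof -
    have "?N x ** ?J *v z = - (?J ** ?N x) *v z" for z
    proof -
      have "?N x ** ?J *v z = N x (J z)"
        by (simp add: matrix_vector_mul_assoc[symmetric] mv N_lin J)
      also have "\<dots> = - (?J ** ?N x *v z)"
        by (simp add: matrix_vector_mul_assoc[symmetric] mv N_lin J N(3))
      finally show ?thesis
        by (simp add: vec_eq_iff matrix_vector_mult_def sum_negf)
    qed
    then show ?thesis by (simp add: matrix_eq)
  qed
  \<comment> \<open>The contracted vector \<open>z\<close> sits in the inner \<open>N\<close>.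
    Skew-symmetry rewrites \<open>N (N x z) y\<close> as \<open>- N y (N x z)\<close>, so the
    dependence on \<open>z\<close> becomes a product of matrices; this is the origin of the minus
    sign.\<close>
  define A where "A x y = - (?J ** ?N y ** ?N x)" for x y
  have JNN: "J (N (N x z) y) = A x y *v z" for x y z
  proof -
    have "A x y *v z = - (?J ** ?N y ** ?N x *v z)"
      by (simp add: A_def vec_eq_iff matrix_vector_mult_def sum_negf)
    also have "\<dots> = J (- N y (N x z))"
      by (simp add: matrix_vector_mul_assoc[symmetric] mv N_lin J linear_neg)
    finally show ?thesis
      using N(2)[of "N x z" y] by simp
  qed
  \<comment> \<open>The first two terms of the tensor are contractions of type \<open>c\<close>; the
    last two have the indices exchanged and are of type \<open>c'\<close>.\<close>
  define c where "c B = (\<Sum>k\<in>UNIV. \<Sum>l\<in>UNIV. matrix_inv G $ k $ l * b (B *v e k) (e l))" for B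
  define c' where "c' B = (\<Sum>k\<in>UNIV. \<Sum>l\<in>UNIV. matrix_inv G $ k $ l * b (B *v e l) (e k))" for B
  have "c B = trace B" for B
    unfolding c_def G_def by (rule gram_contraction(1)[OF b e])
  moreover have "c' B = trace B" for B
    unfolding c'_def G_def by (rule gram_contraction(2)[OF b e])
  ultimately have contr: "c B = trace B" "c' B = trace B" for B
    by simp_all
  have "(\<Sum>k\<in>UNIV. \<Sum>l\<in>UNIV. matrix_inv G $ k $ l *
           (1 / 4 * (b (J (N (N x (e k)) y)) (e l) + b (J (N (N y (e k)) x)) (e l)
                   + b (J (N (N x (e l)) y)) (e k) + b (J (N (N y (e l)) x)) (e k))))
      = 1 / 4 * (c (A x y) + c (A y x) + c' (A x y) + c' (A y x))"
    unfolding JNN c_def c'_def by (simp add: sum.distrib sum_distrib_left distrib_left mult.left_commute)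
  also have "\<dots> = 1 / 4 * (trace (A x y) + trace (A y x) + trace (A x y) + trace (A y x))"
    by (simp add: contr)
  also have "\<dots> = 0"
    using trace_anticommuting[OF anti, of x "?N y"]
    by (simp add: A_def trace_def sum_negf)
  finally show ?thesis .
qed

section \<open>Tangent vectors and Lie brackets\<close>

locale smooth_manifold =
  fixes A :: "('m::topological_space, 'n::finite) chart set"
  assumes smooth_atlas: "smooth_atlas A"
begin

abbreviation Dtrans :: "('m, 'n) chart \<Rightarrow> ('m, 'n) chart \<Rightarrow> 'm \<Rightarrow> real ^ 'n \<Rightarrow> real ^ 'n"
  where "Dtrans c d p \<equiv> frechet_derivative (transition c d) (at (cmap c p))"

section \<open>Charts and the Jacobians of transition maps\<close>

lemma chart_homeomorphism:
  assumes "c \<in> A"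
  shows "homeomorphism (cdom c) (cmap c ` cdom c) (cmap c) (cinv c)"
  using smooth_atlas assms by (simp add: smooth_atlas_def is_chart_def)

lemma open_cdom: "c \<in> A \<Longrightarrow> open (cdom c)"
  using smooth_atlas by (simp add: smooth_atlas_def is_chart_def)

lemma cinv_cmap: "c \<in> A \<Longrightarrow> p \<in> cdom c \<Longrightarrow> cinv c (cmap c p) = p"
  using chart_homeomorphism by (rule homeomorphism_apply1)

lemma open_cmap_image:
  assumes "c \<in> A" "open U" "U \<subseteq> cdom c"
  shows "open (cmap c ` U)"
proof -
  have "openin (top_of_set (cdom c)) U"
    using assms(2,3) by (rule open_subset[rotated])
  then have "openin (top_of_set (cmap c ` cdom c)) (cmap c ` U)"
    by (rule homeomorphism_imp_open_map[OF chart_homeomorphism[OF assms(1)]])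
  moreover have "open (cmap c ` cdom c)"
    using smooth_atlas assms(1) by (simp add: smooth_atlas_def is_chart_def)
  ultimately show ?thesis
    by (rule openin_open_trans)
qed

lemma open_overlap:
  "c \<in> A \<Longrightarrow> d \<in> A \<Longrightarrow> open (cmap c ` (cdom c \<inter> cdom d))"
  by (rule open_cmap_image) (auto intro: open_Int open_cdom)

lemma charts_at_iff: "c \<in> charts_at A p \<longleftrightarrow> c \<in> A \<and> p \<in> cdom c"
  by (simp add: charts_at_def)

lemma ex_chart: "\<exists>c. c \<in> charts_at A p"
proof -
  have "p \<in> (\<Union>c\<in>A. cdom c)"
    using smooth_atlas by (simp add: smooth_atlas_def)
  then show ?thesis
    by (auto simp: charts_at_iff)
qed

lemma transition_cmap: "c \<in> A \<Longrightarrow> p \<in> cdom c \<Longrightarrow> transition c d (cmap c p) = cmap d p"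
  by (simp add: transition_def cinv_cmap)

lemma smooth_transition:
  "c \<in> A \<Longrightarrow> d \<in> A \<Longrightarrow> smooth_on (cmap c ` (cdom c \<inter> cdom d)) (transition c d)"
  using smooth_atlas by (simp add: smooth_atlas_def)

lemma transition_has_derivative:
  assumes "c \<in> charts_at A p" "d \<in> charts_at A p"
  shows "(transition c d has_derivative Dtrans c d p) (at (cmap c p))"
  using assms by (intro smooth_on_has_derivative[OF smooth_transition]) (auto simp: charts_at_iff)

lemma linear_Dtrans: "c \<in> charts_at A p \<Longrightarrow> d \<in> charts_at A p \<Longrightarrow> linear (Dtrans c d p)"
  using transition_has_derivative has_derivative_linear by blast

text \<open>The transition maps compose on the image of the triple overlap, which is open, so the
  cocycle rule follows from the chain rule and uniqueness of derivatives.\<close>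

lemma Dtrans_trans:
  assumes "c \<in> charts_at A p" "d \<in> charts_at A p" "e \<in> charts_at A p"
  shows "Dtrans d e p (Dtrans c d p a) = Dtrans c e p a"
proof -
  have A: "c \<in> A" "d \<in> A" "e \<in> A" and p: "p \<in> cdom c" "p \<in> cdom d" "p \<in> cdom e"
    using assms by (auto simp: charts_at_iff)
  let ?U = "cdom c \<inter> cdom d \<inter> cdom e"
  have "((\<lambda>x. transition d e (transition c d x)) has_derivative (\<lambda>h. Dtrans d e p (Dtrans c d p h)))
      (at (cmap c p))"
    using transition_has_derivative[OF assms(2,3)] transition_cmap[OF A(1) p(1)]
    by (intro has_derivative_compose[OF transition_has_derivative[OF assms(1,2)]]) simp
  moreover have "open (cmap c ` ?U)"
    using A by (intro open_cmap_image) (auto intro!: open_Int open_cdom)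
  moreover have "cmap c p \<in> cmap c ` ?U"
    using p by blast
  moreover have "transition d e (transition c d x) = transition c e x" if "x \<in> cmap c ` ?U" for x
    using that A by (auto simp: transition_cmap)
  ultimately have "(transition c e has_derivative (\<lambda>h. Dtrans d e p (Dtrans c d p h))) (at (cmap c p))"
    by (rule has_derivative_transform_within_open)
  from has_derivative_unique[OF this transition_has_derivative[OF assms(1,3)]]
  show ?thesis by metis
qed

lemma Dtrans_self:
  assumes "c \<in> charts_at A p"
  shows "Dtrans c c p a = a"
proof -
  have c: "c \<in> A" "p \<in> cdom c"
    using assms by (auto simp: charts_at_iff)
  have "(transition c c has_derivative (\<lambda>h. h)) (at (cmap c p))"
  proof (rule has_derivative_transform_within_open[OF has_derivative_ident])
    show "open (cmap c ` cdom c)"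
      using open_overlap[OF c(1) c(1)] by simp
    show "cmap c p \<in> cmap c ` cdom c"
      using c by simp
    show "x = transition c c x" if "x \<in> cmap c ` cdom c" for x
      using that c by (auto simp: transition_cmap)
  qed
  from has_derivative_unique[OF this transition_has_derivative[OF assms assms]]
  show ?thesis by metis
qed

section \<open>Tangent spaces and their identification with coordinate space\<close>

lemma tangent_space_transform:
  "v \<in> tangent_space A p \<Longrightarrow> c \<in> charts_at A p \<Longrightarrow> d \<in> charts_at A p \<Longrightarrow> v d = Dtrans c d p (v c)"
  unfolding tangent_space_def by blast

lemma tangent_space_eq_0: "v \<in> tangent_space A p \<Longrightarrow> c \<notin> charts_at A p \<Longrightarrow> v c = 0"
  unfolding tangent_space_def by blast

lemma tangent_spaceI:
  assumes "\<And>c d. c \<in> charts_at A p \<Longrightarrow> d \<in> charts_at A p \<Longrightarrow> v d = Dtrans c d p (v c)"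
    and "\<And>c. c \<notin> charts_at A p \<Longrightarrow> v c = 0"
  shows "v \<in> tangent_space A p"
  unfolding tangent_space_def using assms by blast

lemma coord_vec_tangent:
  "c \<in> charts_at A p \<Longrightarrow> coord_vec A c p a \<in> tangent_space A p"
  by (rule tangent_spaceI) (simp_all add: coord_vec_def Dtrans_trans)

lemma coord_vec_same: "c \<in> charts_at A p \<Longrightarrow> coord_vec A c p a c = a"
  by (simp add: coord_vec_def Dtrans_self)

text \<open>Together with \<open>coord_vec_same\<close> this makes \<open>coord_vec A c p\<close> an
  isomorphism from coordinate space to the tangent space, with inverse
  \<open>\<lambda>v. v c\<close>. Pointwise computations are transported along it.\<close>

lemma coord_vec_components:
  assumes "c \<in> charts_at A p" "v \<in> tangent_space A p"
  shows "coord_vec A c p (v c) = v"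
proof
  show "coord_vec A c p (v c) d = v d" for d
    using tangent_space_transform[OF assms(2,1), of d] tangent_space_eq_0[OF assms(2), of d]
    by (simp add: coord_vec_def)
qed

lemma linear_coord_vec:
  assumes "c \<in> charts_at A p"
  shows "linear (coord_vec A c p)"
  using linear_add[OF linear_Dtrans[OF assms]] linear_scale[OF linear_Dtrans[OF assms]]
  by (intro linearI) (auto simp: coord_vec_def fun_eq_iff plus_fun_def scaleR_fun_def)

lemma tangent_space_eq_range: "c \<in> charts_at A p \<Longrightarrow> tangent_space A p = range (coord_vec A c p)"
  using coord_vec_tangent coord_vec_components by (blast intro: range_eqI sym)

lemma subspace_tangent_space: "subspace (tangent_space A p)"
proof -
  obtain c where c: "c \<in> charts_at A p"
    using ex_chart by blast
  show ?thesis
    unfolding tangent_space_eq_range[OF c]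
    by (intro linear_subspace_image linear_coord_vec c subspace_UNIV)
qed

lemma inj_coord_vec: "c \<in> charts_at A p \<Longrightarrow> inj (coord_vec A c p)"
  by (metis coord_vec_same injI)

lemma tangent_eqI:
  assumes "c \<in> charts_at A p" "u \<in> tangent_space A p" "v \<in> tangent_space A p" "u c = v c"
  shows "u = v"
  using assms coord_vec_components by metis

section \<open>Bases of tangent spaces and the evaluation of metric traces\<close>

lemma ex_tangent_basis: "\<exists>e. tangent_basis A p e"
proof -
  obtain c where c: "c \<in> charts_at A p"
    using ex_chart by blast
  let ?e = "\<lambda>i. coord_vec A c p (axis i 1)"
  have range: "range (\<lambda>i :: 'n. axis i 1) = (Basis :: (real ^ 'n) set)"
    by (auto simp: Basis_vec_def)
  have e: "range ?e = coord_vec A c p ` Basis"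
    by (simp add: range[symmetric] image_image)
  have "inj ?e"
  proof (rule injI)
    show "i = j" if "?e i = ?e j" for i j
      using injD[OF inj_coord_vec[OF c] that] by (simp add: axis_eq_axis)
  qed
  moreover have "independent (range ?e)"
    unfolding e using linear_independent_injective_image[OF linear_coord_vec[OF c] independent_Basis]
      inj_coord_vec[OF c] by (simp add: inj_on_subset)
  moreover have "span (range ?e) = tangent_space A p"
    unfolding e linear_span_image[OF linear_coord_vec[OF c]] span_Basis tangent_space_eq_range[OF c] ..
  ultimately show ?thesis
    unfolding tangent_basis_def by blast
qed

lemma tangent_basis_in: "tangent_basis A p e \<Longrightarrow> e i \<in> tangent_space A p"
  unfolding tangent_basis_def using span_base by (metis rangeI)

text \<open>Taking components in \<open>c\<close> is injective on the tangent space, so a vanishing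
  combination of components already vanishes as a tangent vector.\<close>

lemma tangent_basis_components_independent:
  fixes z :: "real ^ 'n"
  assumes "tangent_basis A p e" "c \<in> charts_at A p" "(\<Sum>i\<in>UNIV. z $ i *\<^sub>R e i c) = 0"
  shows "z = 0"
proof -
  have e: "inj e" "independent (range e)"
    using assms(1) by (auto simp: tangent_basis_def)
  have app: "(\<Sum>i\<in>I. z $ i *\<^sub>R e i) d = (\<Sum>i\<in>I. z $ i *\<^sub>R e i d)" for I d
    by (induction I rule: infinite_finite_induct) (auto simp: plus_fun_def scaleR_fun_def)
  have zero: "0 \<in> tangent_space A p"
    using subspace_tangent_space by (rule subspace_0)
  have "(\<Sum>i\<in>UNIV. z $ i *\<^sub>R e i) = 0"
  proof (rule tangent_eqI[OF assms(2) _ zero])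
    show "(\<Sum>i\<in>UNIV. z $ i *\<^sub>R e i) \<in> tangent_space A p"
      by (intro subspace_sum subspace_scale subspace_tangent_space tangent_basis_in[OF assms(1)])
    show "(\<Sum>i\<in>UNIV. z $ i *\<^sub>R e i) c = 0 c"
      by (simp add: app assms(3))
  qed
  \<comment> \<open>Independence is a property of the set \<open>range e\<close>, so the sum over
    indices is rewritten as one over vectors; injectivity of \<open>e\<close> recovers the
    coefficients.\<close>
  then have "(\<Sum>v\<in>range e. (z $ inv e v) *\<^sub>R v) = 0"
    by (simp add: sum.reindex[OF e(1)] inv_f_f[OF e(1)])
  then have "z $ inv e (e i) = 0" for i
    by (intro independentD[OF e(2), of "range e" "\<lambda>v. z $ inv e v"]) auto
  then show ?thesis
    by (simp add: vec_eq_iff inv_f_f[OF e(1)])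
qed

text \<open>\<open>metric_trace\<close> is a definite description quantified over bases. The
  existence of at least one basis is what makes the described number unique.\<close>

lemma metric_trace_eqI:
  assumes "\<And>e. tangent_basis A p e \<Longrightarrow>
    (\<Sum>i\<in>UNIV. \<Sum>j\<in>UNIV. matrix_inv (gram_matrix g p e) $ i $ j * B (e i) (e j)) = t"
  shows "metric_trace A g p B = t"
  unfolding metric_trace_def
  by (rule the_equality) (use ex_tangent_basis[of p] assms in auto)

section \<open>Smooth vector fields and Lie brackets\<close>

lemma smooth_vector_field_coord_vec:
  assumes "c \<in> A"
  shows "smooth_vector_field A (cdom c) (\<lambda>q. coord_vec A c q a)"
  unfolding smooth_vector_field_def
proof (intro conjI ballI)
  show "open (cdom c)"
    using assms by (rule open_cdom)
  show "coord_vec A c p a \<in> tangent_space A p" if "p \<in> cdom c" for p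
    using assms that by (simp add: coord_vec_tangent charts_at_iff)
  fix d assume d: "d \<in> A"
  let ?S = "cmap d ` (cdom c \<inter> cdom d)" and ?T = "cmap c ` (cdom c \<inter> cdom d)"
  have S: "open ?S" and T: "open ?T"
    using open_overlap[OF d assms] open_overlap[OF assms d] by (simp_all add: Int_commute)
  \<comment> \<open>In the chart \<open>d\<close>, the field with constant components
    \<open>a\<close> in \<open>c\<close> has as components a derivative of
    \<open>transition c d\<close> composed with the smooth map
    \<open>transition d c\<close>.\<close>
  have "smooth_on ?S (\<lambda>x. frechet_derivative (transition c d) (at (transition d c x)) a)"
  proof (rule smooth_on_compose[OF S T, where g = "transition d c"])
    show "transition d c ` ?S \<subseteq> ?T"
      using d by (auto simp: transition_cmap)
    show "smooth_on ?S (transition d c)"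
      using smooth_transition[OF d assms] by (simp add: Int_commute)
    show "smooth_on ?T (\<lambda>y. frechet_derivative (transition c d) (at y) a)"
      by (rule smooth_on_frechet_derivative[OF smooth_transition[OF assms d]])
  qed
  moreover have "frechet_derivative (transition c d) (at (transition d c x)) a = coord_vec A c (cinv d x) a d"
    if "x \<in> ?S" for x
    using that d by (auto simp: coord_vec_def charts_at_iff transition_cmap cinv_cmap)
  ultimately show "smooth_on ?S (\<lambda>x. coord_vec A c (cinv d x) a d)"
    by (rule smooth_on_cong[OF S, rotated])
qed

lemma smooth_vector_field_has_derivative:
  assumes "smooth_vector_field A U X" "p \<in> U" "c \<in> charts_at A p"
  shows "((\<lambda>x. X (cinv c x) c) has_derivative frechet_derivative (\<lambda>x. X (cinv c x) c) (at (cmap c p)))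
           (at (cmap c p))"
proof (rule smooth_on_has_derivative)
  show "smooth_on (cmap c ` (U \<inter> cdom c)) (\<lambda>x. X (cinv c x) c)"
    using assms by (auto simp: smooth_vector_field_def charts_at_iff)
  show "cmap c p \<in> cmap c ` (U \<inter> cdom c)"
    using assms by (auto simp: charts_at_iff)
qed

lemma lie_bracket_component:
  assumes "c \<in> charts_at A p" "((\<lambda>x. X (cinv c x) c) has_derivative X') (at (cmap c p))"
    "((\<lambda>x. Y (cinv c x) c) has_derivative Y') (at (cmap c p))"
  shows "lie_bracket A X Y p c = Y' (X p c) - X' (Y p c)"
  using assms by (simp add: lie_bracket_def frechet_derivative_at[symmetric])

text \<open>The second derivatives of the transition map cancel by symmetry.\<close>

lemma lie_bracket_tangent:
  assumes U: "open U" "p \<in> U"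
    and tangent: "\<And>q. q \<in> U \<Longrightarrow> X q \<in> tangent_space A q" "\<And>q. q \<in> U \<Longrightarrow> Y q \<in> tangent_space A q"
    and X: "\<And>c. c \<in> charts_at A p \<Longrightarrow> (\<lambda>x. X (cinv c x) c) differentiable at (cmap c p)"
    and Y: "\<And>c. c \<in> charts_at A p \<Longrightarrow> (\<lambda>x. Y (cinv c x) c) differentiable at (cmap c p)"
  shows "lie_bracket A X Y p \<in> tangent_space A p"
proof -
  have "lie_bracket A X Y p d = Dtrans c d p (lie_bracket A X Y p c)"
    if cd: "c \<in> charts_at A p" "d \<in> charts_at A p" for c d
  proof -
    have A: "c \<in> A" "d \<in> A" and p: "p \<in> cdom c" "p \<in> cdom d"
      using cd by (auto simp: charts_at_iff)
    let ?x = "cmap c p" and ?\<tau> = "transition c d"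
    let ?D2 = "\<lambda>b. frechet_derivative (\<lambda>y. frechet_derivative ?\<tau> (at y) b) (at ?x)"
    let ?D = "\<lambda>Z e. frechet_derivative (\<lambda>x. Z (cinv e x) e) (at (cmap e p))"
    define S where "S = cmap c ` (U \<inter> cdom c \<inter> cdom d)"
    have S: "open S" "?x \<in> S" "S \<subseteq> cmap c ` (cdom c \<inter> cdom d)"
      unfolding S_def using A p U by (auto intro!: open_cmap_image open_Int open_cdom)
    have smooth: "smooth_on S ?\<tau>"
      using smooth_on_subset[OF smooth_transition[OF A] S(3)] .
    \<comment> \<open>The transformation law of \<open>Z\<close>, read in the chart
      \<open>c\<close>, is differentiated in two ways: by the chain rule on one side, and by the
      product rule on the other, where the term \<open>?D2\<close> appears.\<close>
    have transform: "?D Z d (Dtrans c d p h) = Dtrans c d p (?D Z c h) + ?D2 (Z p c) h"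
      if Z: "\<And>q. q \<in> U \<Longrightarrow> Z q \<in> tangent_space A q"
        and Z': "\<And>c. c \<in> charts_at A p \<Longrightarrow> (\<lambda>x. Z (cinv c x) c) differentiable at (cmap c p)"
      for Z :: "'m \<Rightarrow> ('m, 'n) tvec" and h
    proof -
      have D: "((\<lambda>x. Z (cinv e x) e) has_derivative ?D Z e) (at (cmap e p))" if "e \<in> charts_at A p" for e
        using Z'[OF that] by (simp add: frechet_derivative_works)
      have "((\<lambda>x. Z (cinv d x) d) has_derivative ?D Z d) (at (?\<tau> ?x))"
        using D[OF cd(2)] by (simp add: transition_cmap A p)
      from has_derivative_compose[OF transition_has_derivative[OF cd] this]
      have 1: "((\<lambda>x. Z (cinv d (?\<tau> x)) d) has_derivative (\<lambda>h. ?D Z d (Dtrans c d p h))) (at ?x)" .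
      have "((\<lambda>x. frechet_derivative ?\<tau> (at x) (Z (cinv c x) c)) has_derivative
          (\<lambda>h. Dtrans c d p (?D Z c h) + ?D2 (Z (cinv c ?x) c) h)) (at ?x)"
      proof (rule has_derivative_linear_apply[OF S(1,2) _ _ D[OF cd(1)]])
        show "linear (frechet_derivative ?\<tau> (at y))" if "y \<in> S" for y
          using smooth_on_differentiable[OF smooth that] by (rule linear_frechet_derivative)
        show "((\<lambda>y. frechet_derivative ?\<tau> (at y) b) has_derivative ?D2 b) (at ?x)" for b
          by (rule smooth_on_has_derivative[OF smooth_on_frechet_derivative[OF smooth] S(2)])
      qed
      moreover have "frechet_derivative ?\<tau> (at x) (Z (cinv c x) c) = Z (cinv d (?\<tau> x)) d" if "x \<in> S" for x
      proof -
        obtain q where q: "q \<in> U" "q \<in> cdom c" "q \<in> cdom d" "x = cmap c q"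
          using \<open>x \<in> S\<close> by (auto simp: S_def)
        then show ?thesis
          using tangent_space_transform[OF Z[OF q(1)], of c d] A
          by (simp add: charts_at_iff transition_cmap cinv_cmap)
      qed
      ultimately have "((\<lambda>x. Z (cinv d (?\<tau> x)) d) has_derivative
          (\<lambda>h. Dtrans c d p (?D Z c h) + ?D2 (Z (cinv c ?x) c) h)) (at ?x)"
        by (rule has_derivative_transform_within_open[OF _ S(1,2)])
      from has_derivative_unique[OF 1 this, THEN fun_cong, of h] show ?thesis
        by (simp add: cinv_cmap A p)
    qed
    have comp: "X p d = Dtrans c d p (X p c)" "Y p d = Dtrans c d p (Y p c)"
      using tangent U(2) cd tangent_space_transform by blast+
    have "?D2 (Y p c) (X p c) = ?D2 (X p c) (Y p c)"
      by (rule smooth_on_second_derivative_symmetric[OF S(1,2) smooth])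
    then have "?D Y d (X p d) - ?D X d (Y p d) = Dtrans c d p (?D Y c (X p c)) - Dtrans c d p (?D X c (Y p c))"
      unfolding comp by (simp add: transform[OF tangent(1) X] transform[OF tangent(2) Y])
    then show ?thesis
      using cd by (simp add: lie_bracket_def linear_diff[OF linear_Dtrans[OF cd]])
  qed
  then show ?thesis
    by (rule tangent_spaceI) (simp_all add: lie_bracket_def)
qed

end

section \<open>The Nijenhuis tensor\<close>

locale almost_complex_manifold = smooth_manifold A
  for A :: "('m::topological_space, 'n::finite) chart set" +
  fixes J :: "'m \<Rightarrow> ('m, 'n) tvec \<Rightarrow> ('m, 'n) tvec"
  assumes almost_complex: "almost_complex A J"
begin

section \<open>The almost-complex structure and its derivative in a chart\<close>

definition Jcoord :: "('m, 'n) chart \<Rightarrow> 'm \<Rightarrow> real ^ 'n \<Rightarrow> real ^ 'n"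
  where "Jcoord c p a = J p (coord_vec A c p a) c"

text \<open>The first vector argument is the one \<open>J\<close> is applied to; the remaining one
  is the direction of differentiation.\<close>

definition DJ :: "('m, 'n) chart \<Rightarrow> 'm \<Rightarrow> real ^ 'n \<Rightarrow> real ^ 'n \<Rightarrow> real ^ 'n"
  where "DJ c p a = frechet_derivative (\<lambda>x. Jcoord c (cinv c x) a) (at (cmap c p))"

lemma J_tangent: "u \<in> tangent_space A p \<Longrightarrow> J p u \<in> tangent_space A p"
  using almost_complex by (simp add: almost_complex_def)

lemma J_J: "u \<in> tangent_space A p \<Longrightarrow> J p (J p u) = - u"
  using almost_complex by (simp add: almost_complex_def)

lemma J_component:
  "c \<in> charts_at A p \<Longrightarrow> u \<in> tangent_space A p \<Longrightarrow> J p u c = Jcoord c p (u c)"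
  by (simp add: Jcoord_def coord_vec_components)

lemma linear_Jcoord:
  assumes "c \<in> charts_at A p"
  shows "linear (Jcoord c p)"
proof (rule linearI)
  note T = coord_vec_tangent[OF assms] and L = linear_coord_vec[OF assms]
  have "J p (u + v) = J p u + J p v" "J p (r *\<^sub>R u) = r *\<^sub>R J p u"
    if "u \<in> tangent_space A p" "v \<in> tangent_space A p" for u v r
    using almost_complex that unfolding almost_complex_def by blast+
  note J = this
  show "Jcoord c p (a + b) = Jcoord c p a + Jcoord c p b" for a b
    by (simp add: Jcoord_def linear_add[OF L] J(1)[OF T T])
  show "Jcoord c p (r *\<^sub>R a) = r *\<^sub>R Jcoord c p a" for r a
    unfolding Jcoord_def linear_scale[OF L] J(2)[OF T T] by (simp add: scaleR_fun_def)
qed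

lemma Jcoord_Jcoord:
  assumes "c \<in> charts_at A p"
  shows "Jcoord c p (Jcoord c p a) = - a"
proof -
  let ?u = "coord_vec A c p a"
  have u: "?u \<in> tangent_space A p"
    by (rule coord_vec_tangent[OF assms])
  have "Jcoord c p (Jcoord c p a) = J p (J p ?u) c"
    using J_component[OF assms J_tangent[OF u]] J_component[OF assms u]
    by (simp add: coord_vec_same[OF assms])
  also have "\<dots> = - a"
    by (simp add: J_J[OF u] coord_vec_same[OF assms])
  finally show ?thesis .
qed

lemma Jcoord_has_derivative:
  assumes "c \<in> charts_at A p"
  shows "((\<lambda>x. Jcoord c (cinv c x) a) has_derivative DJ c p a) (at (cmap c p))"
  unfolding DJ_def
proof (rule smooth_on_has_derivative)
  show "smooth_on (cmap c ` cdom c) (\<lambda>x. Jcoord c (cinv c x) a)"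
    using almost_complex assms by (simp add: almost_complex_def Jcoord_def charts_at_iff)
  show "cmap c p \<in> cmap c ` cdom c"
    using assms by (simp add: charts_at_iff)
qed

lemma linear_Jcoord_cinv:
  assumes "c \<in> A" "x \<in> cmap c ` cdom c"
  shows "linear (Jcoord c (cinv c x))"
  using assms by (auto simp: cinv_cmap charts_at_iff intro!: linear_Jcoord)

lemma Jcoord_apply_has_derivative:
  assumes c: "c \<in> charts_at A p" and X: "(X has_derivative X') (at (cmap c p))"
  shows "((\<lambda>x. Jcoord c (cinv c x) (X x)) has_derivative
           (\<lambda>h. Jcoord c p (X' h) + DJ c p (X (cmap c p)) h)) (at (cmap c p))"
proof -
  have cA: "c \<in> A" "p \<in> cdom c"
    using c by (auto simp: charts_at_iff)
  have "((\<lambda>x. Jcoord c (cinv c x) (X x)) has_derivative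
      (\<lambda>h. Jcoord c (cinv c (cmap c p)) (X' h) + DJ c p (X (cmap c p)) h)) (at (cmap c p))"
  proof (rule has_derivative_linear_apply[OF _ _ _ Jcoord_has_derivative[OF c] X])
    show "open (cmap c ` cdom c)"
      using open_overlap[OF cA(1) cA(1)] by simp
    show "cmap c p \<in> cmap c ` cdom c"
      using cA by simp
  qed (rule linear_Jcoord_cinv[OF cA(1)])
  then show ?thesis
    by (simp add: cinv_cmap cA)
qed

text \<open>Linearity in the direction holds for any derivative; linearity in the other slot is
  inherited from that of \<open>Jcoord\<close> at all nearby points.\<close>

lemma bilinear_DJ:
  assumes "c \<in> charts_at A p"
  shows "bilinear (DJ c p)"
  unfolding bilinear_def
proof (intro conjI allI)
  have cA: "c \<in> A" "p \<in> cdom c"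
    using assms by (auto simp: charts_at_iff)
  show "linear (DJ c p a)" for a
    by (rule has_derivative_linear[OF Jcoord_has_derivative[OF assms]])
  show "linear (\<lambda>a. DJ c p a h)" for h
  proof (rule has_derivative_linear_apply_linear[OF _ _ _ Jcoord_has_derivative[OF assms]])
    show "open (cmap c ` cdom c)"
      using open_overlap[OF cA(1) cA(1)] by simp
    show "cmap c p \<in> cmap c ` cdom c"
      using cA by simp
  qed (rule linear_Jcoord_cinv[OF cA(1)])
qed

text \<open>Applying \<open>Jcoord\<close> twice to \<open>a\<close> gives \<open>- a\<close> at
  every point of the chart, so the derivative is zero; the product rule computes the same derivative
  as a sum of two terms.\<close>

lemma DJ_Jcoord:
  assumes "c \<in> charts_at A p"
  shows "DJ c p (Jcoord c p a) h = - Jcoord c p (DJ c p a h)"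
proof -
  have cA: "c \<in> A" "p \<in> cdom c"
    using assms by (auto simp: charts_at_iff)
  have "((\<lambda>x. - a) has_derivative
      (\<lambda>h. Jcoord c p (DJ c p a h) + DJ c p (Jcoord c (cinv c (cmap c p)) a) h)) (at (cmap c p))"
  proof (rule has_derivative_transform_within_open)
    show "((\<lambda>x. Jcoord c (cinv c x) (Jcoord c (cinv c x) a)) has_derivative
        (\<lambda>h. Jcoord c p (DJ c p a h) + DJ c p (Jcoord c (cinv c (cmap c p)) a) h)) (at (cmap c p))"
      by (rule Jcoord_apply_has_derivative[OF assms Jcoord_has_derivative[OF assms]])
    show "open (cmap c ` cdom c)"
      using open_overlap[OF cA(1) cA(1)] by simp
    show "cmap c p \<in> cmap c ` cdom c"
      using cA by simp
    show "Jcoord c (cinv c x) (Jcoord c (cinv c x) a) = - a" if "x \<in> cmap c ` cdom c" for x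
      using that cA by (auto simp: cinv_cmap charts_at_iff intro!: Jcoord_Jcoord)
  qed
  from has_derivative_unique[OF this has_derivative_const, THEN fun_cong, of h]
  show ?thesis
    by (simp add: cinv_cmap cA eq_neg_iff_add_eq_0 add.commute)
qed

text \<open>The part of N(X, Y) that survives when the derivatives of the fields cancel, with
  \<open>a\<close> and \<open>b\<close> the components of X and Y. The first two terms come from
  [JX, JY], the third from - J[X, JY] and the fourth from - J[JX, Y].\<close>

definition Ncoord :: "('m, 'n) chart \<Rightarrow> 'm \<Rightarrow> real ^ 'n \<Rightarrow> real ^ 'n \<Rightarrow> real ^ 'n"
  where "Ncoord c p a b = DJ c p b (Jcoord c p a) - DJ c p a (Jcoord c p b)
           - Jcoord c p (DJ c p b a) + Jcoord c p (DJ c p a b)"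

lemma bilinear_Ncoord:
  assumes "c \<in> charts_at A p"
  shows "bilinear (Ncoord c p)"
proof -
  note D = bilinear_DJ[OF assms] and L = linear_Jcoord[OF assms]
  show ?thesis
    unfolding bilinear_def
    by (intro conjI allI linearI)
      (simp_all add: Ncoord_def linear_add[OF L] linear_scale[OF L] bilinear_ladd[OF D] bilinear_radd[OF D]
        bilinear_lmul[OF D] bilinear_rmul[OF D] scaleR_right_diff_distrib scaleR_right_distrib)
qed

lemma Ncoord_skew: "Ncoord c p a b = - Ncoord c p b a"
  by (simp add: Ncoord_def)

text \<open>\<open>DJ_Jcoord\<close> pulls \<open>Jcoord\<close> out of the first slot of
  \<open>DJ\<close> with a sign, while a double \<open>Jcoord\<close> in the second slot is just a
  sign.\<close>

lemma Ncoord_Jcoord: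
  assumes "c \<in> charts_at A p"
  shows "Ncoord c p a (Jcoord c p b) = - Jcoord c p (Ncoord c p a b)"
proof -
  note D = bilinear_DJ[OF assms] and L = linear_Jcoord[OF assms]
  show ?thesis
    by (simp add: Ncoord_def DJ_Jcoord[OF assms] Jcoord_Jcoord[OF assms] linear_add[OF L] linear_diff[OF L]
        linear_neg[OF L] bilinear_rneg[OF D])
qed

section \<open>The Nijenhuis tensor computed in a chart\<close>

lemma J_field_has_derivative:
  assumes X: "smooth_vector_field A U X" "p \<in> U" and c: "c \<in> charts_at A p"
  shows "((\<lambda>x. J (cinv c x) (X (cinv c x)) c) has_derivative
     (\<lambda>h. Jcoord c p (frechet_derivative (\<lambda>x. X (cinv c x) c) (at (cmap c p)) h) + DJ c p (X p c) h))
     (at (cmap c p))"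
proof -
  have cA: "c \<in> A" "p \<in> cdom c"
    using c by (auto simp: charts_at_iff)
  have U: "open U" "\<And>q. q \<in> U \<Longrightarrow> X q \<in> tangent_space A q"
    using X(1) by (auto simp: smooth_vector_field_def)
  show ?thesis
  proof (rule has_derivative_transform_within_open)
    show "((\<lambda>x. Jcoord c (cinv c x) (X (cinv c x) c)) has_derivative
       (\<lambda>h. Jcoord c p (frechet_derivative (\<lambda>x. X (cinv c x) c) (at (cmap c p)) h) + DJ c p (X p c) h))
       (at (cmap c p))"
      using Jcoord_apply_has_derivative[OF c smooth_vector_field_has_derivative[OF X c]]
      by (simp add: cinv_cmap cA)
    show "open (cmap c ` (U \<inter> cdom c))"
      using cA U by (intro open_cmap_image) (auto intro!: open_Int open_cdom)
    show "cmap c p \<in> cmap c ` (U \<inter> cdom c)"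
      using cA X by simp
    show "Jcoord c (cinv c x) (X (cinv c x) c) = J (cinv c x) (X (cinv c x)) c"
      if "x \<in> cmap c ` (U \<inter> cdom c)" for x
      using that cA U by (auto simp: cinv_cmap charts_at_iff J_component)
  qed
qed

lemma nijenhuis_field_tangent_component:
  assumes X: "smooth_vector_field A U X" and Y: "smooth_vector_field A U Y" and p: "p \<in> U"
  shows "nijenhuis_field A J X Y p \<in> tangent_space A p" (is ?tangent)
    and "c \<in> charts_at A p \<Longrightarrow> nijenhuis_field A J X Y p c = Ncoord c p (X p c) (Y p c)"
proof -
  let ?JX = "\<lambda>q. J q (X q)" and ?JY = "\<lambda>q. J q (Y q)"
  let ?T = "tangent_space A p"
  have U: "open U" and XT: "\<And>q. q \<in> U \<Longrightarrow> X q \<in> tangent_space A q"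
    and YT: "\<And>q. q \<in> U \<Longrightarrow> Y q \<in> tangent_space A q"
    using X Y by (auto simp: smooth_vector_field_def)
  note XD = smooth_vector_field_has_derivative[OF X p] and YD = smooth_vector_field_has_derivative[OF Y p]
    and JXD = J_field_has_derivative[OF X p] and JYD = J_field_has_derivative[OF Y p]
  note br = lie_bracket_tangent[OF U p]
  \<comment> \<open>\<open>lie_bracket_tangent\<close> asks only for tangency and differentiability
    at \<open>p\<close>, so the fields \<open>?JX\<close> and \<open>?JY\<close> qualify through
    their explicit derivatives.\<close>
  have T: "lie_bracket A ?JX ?JY p \<in> ?T" "lie_bracket A X ?JY p \<in> ?T"
    "lie_bracket A ?JX Y p \<in> ?T" "lie_bracket A X Y p \<in> ?T"
    by (rule br; use XT YT XD YD JXD JYD in \<open>blast intro: J_tangent differentiableI\<close>)+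
  show ?tangent
    unfolding nijenhuis_field_def Let_def
    by (intro subspace_diff subspace_tangent_space T J_tangent)
  assume c: "c \<in> charts_at A p"
  note D = bilinear_DJ[OF c] and L = linear_Jcoord[OF c]
  have comp: "J p (X p) c = Jcoord c p (X p c)" "J p (Y p) c = Jcoord c p (Y p c)"
    using J_component c XT YT p by blast+
  show "nijenhuis_field A J X Y p c = Ncoord c p (X p c) (Y p c)"
    unfolding nijenhuis_field_def Let_def
    by (simp add: J_component[OF c T(2)] J_component[OF c T(3)] comp
        lie_bracket_component[where X = ?JX and Y = ?JY, OF c JXD[OF c] JYD[OF c]]
        lie_bracket_component[where X = X and Y = ?JY, OF c XD[OF c] JYD[OF c]]
        lie_bracket_component[where X = ?JX and Y = Y, OF c JXD[OF c] YD[OF c]]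
        lie_bracket_component[where X = X and Y = Y, OF c XD[OF c] YD[OF c]]
        linear_add[OF L] linear_diff[OF L] Jcoord_Jcoord[OF c] Ncoord_def)
qed

text \<open>By the previous lemma all extensions of \<open>u\<close> and \<open>v\<close> give the
  same value at \<open>p\<close>, which resolves the definite description in
  \<open>nijenhuis\<close>.\<close>

lemma nijenhuis_tangent_component:
  assumes u: "u \<in> tangent_space A p" and v: "v \<in> tangent_space A p"
  shows "nijenhuis A J p u v \<in> tangent_space A p"
    and "c \<in> charts_at A p \<Longrightarrow> nijenhuis A J p u v c = Ncoord c p (u c) (v c)"
proof -
  have N: "nijenhuis A J p u v = coord_vec A c p (Ncoord c p (u c) (v c))" if c: "c \<in> charts_at A p" for c
    unfolding nijenhuis_def
  proof (rule the_equality)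
    let ?w = "coord_vec A c p (Ncoord c p (u c) (v c))"
    show *: "\<forall>U X Y. p \<in> U \<and> smooth_vector_field A U X \<and> smooth_vector_field A U Y \<and> X p = u \<and> Y p = v \<longrightarrow>
        nijenhuis_field A J X Y p = ?w"
    proof (intro allI impI, elim conjE)
      fix U X Y
      assume *: "p \<in> U" "smooth_vector_field A U X" "smooth_vector_field A U Y" "X p = u" "Y p = v"
      show "nijenhuis_field A J X Y p = ?w"
        using coord_vec_components[OF c nijenhuis_field_tangent_component(1)[OF *(2,3,1)]]
          nijenhuis_field_tangent_component(2)[OF *(2,3,1) c] *(4,5)
        by simp
    qed
    fix w
    assume w: "\<forall>U X Y. p \<in> U \<and> smooth_vector_field A U X \<and> smooth_vector_field A U Y \<and> X p = u \<and> Y p = v \<longrightarrow>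
        nijenhuis_field A J X Y p = w"
    \<comment> \<open>Uniqueness requires at least one pair of extensions, since otherwise every
      \<open>w\<close> would qualify. Fields with constant components in \<open>c\<close> provide
      it.\<close>
    let ?X = "\<lambda>q. coord_vec A c q (u c)" and ?Y = "\<lambda>q. coord_vec A c q (v c)"
    have ext: "p \<in> cdom c \<and> smooth_vector_field A (cdom c) ?X \<and> smooth_vector_field A (cdom c) ?Y \<and>
        ?X p = u \<and> ?Y p = v"
      using c u v by (simp add: charts_at_iff smooth_vector_field_coord_vec coord_vec_components)
    show "w = ?w"
      using *[rule_format, OF ext] w[rule_format, OF ext] by simp
  qed
  obtain d where "d \<in> charts_at A p"
    using ex_chart by blast
  with N show "nijenhuis A J p u v \<in> tangent_space A p"
    by (simp add: coord_vec_tangent)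
  show "c \<in> charts_at A p \<Longrightarrow> nijenhuis A J p u v c = Ncoord c p (u c) (v c)"
    by (simp add: N coord_vec_same)
qed

section \<open>Vanishing of the inner and outer traces\<close>

lemma L_tensor_trace_eq_0:
  assumes g: "riemannian_metric A g" and X: "X \<in> tangent_space A p" and Y: "Y \<in> tangent_space A p"
  shows "metric_trace A g p (\<lambda>Z W. L_tensor A J g p X Z Y W) = 0"
proof (rule metric_trace_eqI)
  fix e assume e: "tangent_basis A p e"
  obtain c where c: "c \<in> charts_at A p"
    using ex_chart by blast
  note T = coord_vec_tangent[OF c] and L = linear_coord_vec[OF c]
  \<comment> \<open>From here metric, basis, \<open>J\<close> and the Nijenhuis tensor are replaced
    by their component versions in \<open>c\<close>, so that \<open>contraction_eq_0\<close>
    applies.\<close>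
  define b where "b x y = g p (coord_vec A c p x) (coord_vec A c p y)" for x y
  have g_add: "g p (u + v) w = g p u w + g p v w" and g_scale: "g p (r *\<^sub>R u) v = r * g p u v"
    and g_sym: "g p u v = g p v u" and g_pos: "u \<noteq> 0 \<Longrightarrow> 0 < g p u u"
    if "u \<in> tangent_space A p" "v \<in> tangent_space A p" "w \<in> tangent_space A p" for u v w r
    using g that unfolding riemannian_metric_def by blast+
  have b_sym: "b x y = b y x" for x y
    unfolding b_def by (rule g_sym[OF T T T])
  have "linear (\<lambda>x. b x y)" for y
    by (rule linearI) (simp_all add: b_def linear_add[OF L] linear_scale[OF L] g_add[OF T T T] g_scale[OF T T T])
  then have b: "bilinear b"
    unfolding bilinear_def using b_sym by (metis (no_types, lifting) ext)
  have b_pos: "0 < b x x" if "x \<noteq> 0" for x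
  proof -
    have "coord_vec A c p x \<noteq> 0"
      using that coord_vec_same[OF c, of x] by auto
    then show ?thesis
      unfolding b_def by (rule g_pos[OF T T T])
  qed
  have g_b: "g p u v = b (u c) (v c)" if "u \<in> tangent_space A p" "v \<in> tangent_space A p" for u v
    using that by (simp add: b_def coord_vec_components[OF c])
  note eT = tangent_basis_in[OF e] and NT = nijenhuis_tangent_component(1)
  have gram: "gram_matrix g p e = (\<chi> i j. b (e i c) (e j c))"
    by (simp add: gram_matrix_def g_b eT)
  have JNN: "g p (J p (nijenhuis A J p (nijenhuis A J p u v) w)) z =
      b (Jcoord c p (Ncoord c p (Ncoord c p (u c) (v c)) (w c))) (z c)"
    if "u \<in> tangent_space A p" "v \<in> tangent_space A p" "w \<in> tangent_space A p" "z \<in> tangent_space A p"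
    for u v w z
    using that by (simp add: g_b J_tangent NT J_component[OF c] nijenhuis_tangent_component(2)[OF _ _ c])
  show "(\<Sum>i\<in>UNIV. \<Sum>j\<in>UNIV. matrix_inv (gram_matrix g p e) $ i $ j * L_tensor A J g p X (e i) Y (e j)) = 0"
    unfolding gram L_tensor_def Let_def
    by (simp only: JNN X Y eT)
      (rule contraction_eq_0[OF b b_sym b_pos tangent_basis_components_independent[OF e c]
          linear_Jcoord[OF c] bilinear_Ncoord[OF c] Ncoord_skew Ncoord_Jcoord[OF c]])
qed

text \<open>Every entry of the bilinear form in the outer trace is an inner trace of tangent basis
  vectors, hence zero.\<close>

lemma weak_N_squared_eq_0:
  assumes "riemannian_metric A g"
  shows "weak_N_squared A J g p = 0"
  unfolding weak_N_squared_def
  by (rule metric_trace_eqI) (simp add: L_tensor_trace_eq_0[OF assms] tangent_basis_in)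

end

theorem theorem2p1:
  fixes A :: "('m::{t2_space, second_countable_topology}, 'n::finite) chart set"
    and J :: "'m \<Rightarrow> ('m, 'n) tvec \<Rightarrow> ('m, 'n) tvec"
  assumes "smooth_atlas A"
    and "almost_complex A J"
  shows "(\<forall>g h. riemannian_metric A g \<and> riemannian_metric A h \<longrightarrow>
            weak_N_squared A J g = weak_N_squared A J h) \<and>
         (\<forall>g. riemannian_metric A g \<longrightarrow> weak_N_squared A J g = (\<lambda>p. 0))"
proof -
  interpret almost_complex_manifold A J
    using assms by unfold_locales
  show ?thesis
    by (simp add: fun_eq_iff weak_N_squared_eq_0)
qed

end
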